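(* Let $d<p<\infty$, and let $\Omega\subset\mathbb{R}^d$ be a regular domain with boundary decomposition $\partial\Omega=\partial\Omega_D\cup\partial\Omega_N$. Suppose that the origin is exterior to $\Omega$, that $\partial\Omega_N$ is starlike with respect to the origin, and that the exterior of $\Omega$ adjacent to $\partial\Omega_N$ is away from the origin. Then for all $\zeta\in\mathcal{D}(\Omega,\partial\Omega_D)$, $$\int_\Omega|\nabla\zeta|^p\,dx\ \ge\ \left(\frac{p-d}{p}\right)^p\int_\Omega\left|\frac{\zeta}{|\mathbf{x}|}\right|^p dx .$$ Consequently, $$\lambda_1(\Omega,\partial\Omega_D,p)\ \ge\ \left(\frac{p-d}{p\,\sup\{|\mathbf{x}|:\mathbf{x}\in\Omega\}}\right)^p .$$ Moreover, for any $\gamma$ with $0\le\gamma\le 1$, $$\lambda_1(\Omega,\partial\Omega_D,p)\ \ge\ \inf_{\mathbf{x}\in\Omega}\left(\gamma\left(\frac{p-d}{p|\mathbf{x}|}\right)^p+(1-\gamma)\frac{(p-1)^{p-2}}{p^p\,m(\mathbf{x})^p}\right).$$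
   Context: $\Omega$ is a bounded domain in $\mathbb{R}^d$ whose boundary consists of two pieces, $\partial\Omega_D$ and $\partial\Omega_N:=\partial\Omega\setminus\partial\Omega_D$, each of positive $(d-1)$-dimensional surface measure. $\Omega$ is called regular if its boundary is of class $C$ (locally, in suitable Cartesian coordinates, $\partial\Omega$ is the graph of a continuous function with $\Omega$ lying on one side of it) and is $C^1$ a.e. with respect to surface measure. The outward unit normal $\nu$ exists a.e. on $\partial\Omega_N$. Standing assumption: the boundary is sufficiently regular that Green's formula (the Gauss–Green/divergence theorem) is valid on $\Omega$ for the test functions considered. Test functions: $\mathcal{D}(\Omega,\partial\Omega_D)$ is the set of restrictions to $\Omega$ of functions in $C_c^\infty(\mathbb{R}^d\setminus\partial\Omega_D)$; no boundary condition is imposed on $\partial\Omega_N$. The fundamental eigenvalue of the $p$-Laplacian with respect to $\Omega,\partial\Omega_D$ is $$\lambda_1(\Omega,\partial\Omega_D,p):=\inf\left\{\frac{\int_\Omega|\nabla\zeta|^p\,dx}{\int_\Omega|\zeta|^p\,dx}:\ \zeta\in\mathcal{D}(\Omega,\partial\Omega_D),\ \zeta\not\equiv 0\right\}.$$ Geometric hypotheses: the origin is exterior to $\Omega$ means $0\notin\overline\Omega$. That $\partial\Omega_N$ is starlike with respect to the origin (rays from the origin meet it at most once) with the exterior of $\Omega$ adjacent to $\partial\Omega_N$ away from the origin means that $\Omega$ lies on the side of $\partial\Omega_N$ facing the origin, so that $\nu\cdot\mathbf{x}\ge 0$ a.e. on $\partial\Omega_N$. Averaged distance to the Dirichlet boundary: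 for $\mathbf{x}\in\Omega$ let $K=K(\mathbf{x})\subset S^{d-1}$ be the set of unit vectors $\mathbf{u}$ such that the segment starting at $\mathbf{x}$ in direction $\mathbf{u}$ runs inside $\Omega$ until it ends at a point of $\partial\Omega_D$, and let $d_{\mathbf{u}}(\mathbf{x})$ be the length of that segment. Define $$\frac{1}{m(\mathbf{x})^p}:=\frac{1}{\omega_d}\int_K\frac{dS(\mathbf{u})}{d_{\mathbf{u}}(\mathbf{x})^p},$$ where $dS$ is the surface measure on $S^{d-1}$ and $\omega_d$ is its total mass. $K$ may be empty, in which case $1/m(\mathbf{x})^p=0$.
   Formalization: In dimension d=1 the last bound (with γ and m) is stated only for p ≥ 2, because as printed it fails there for p near 1, e.g. Ω=(a,a+1), a>0, Dirichlet part {a}, γ=0, p=1.1; for d ≥ 2 nothing changes. *)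

theory Defs
  imports "HOL-Analysis.Analysis"
begin

section \<open>Differentiability classes\<close>

text \<open>The class \<open>C\<^sup>k\<close> on \<open>S\<close>, intended for open \<open>S\<close>: iterated Frechet derivatives are
  handled through directional derivatives, which is equivalent in finite dimension.\<close>

primrec Ck_on ::
  "nat \<Rightarrow> ('a::euclidean_space \<Rightarrow> 'b::real_normed_vector) \<Rightarrow> 'a set \<Rightarrow> bool" where
  "Ck_on 0 f S \<longleftrightarrow> continuous_on S f"
| "Ck_on (Suc k) f S \<longleftrightarrow>
     (\<forall>x\<in>S. f differentiable at x) \<and>
     (\<forall>v. Ck_on k (\<lambda>x. frechet_derivative f (at x) v) S)"

definition grad :: "('a::euclidean_space \<Rightarrow> real) \<Rightarrow> 'a \<Rightarrow> 'a" where
  "grad f x = (\<Sum>b\<in>Basis. frechet_derivative f (at x) b *\<^sub>R b)"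

definition divergence :: "('a::euclidean_space \<Rightarrow> 'a) \<Rightarrow> 'a \<Rightarrow> real" where
  "divergence F x = (\<Sum>b\<in>Basis. frechet_derivative F (at x) b \<bullet> b)"

section \<open>Surface measure\<close>

text \<open>Hausdorff measure, normalised so that in dimension \<open>n\<close> it is the usual \<open>n\<close>-dimensional
  volume. Boundedness is required because \<^term>\<open>diameter\<close> is unspecified on unbounded sets;
  empty sets are singled out because \<open>0 ^ 0 = 1\<close> (relevant for \<open>n = 0\<close>).\<close>

definition hausdorff_premeasure :: "nat \<Rightarrow> real \<Rightarrow> 'a::euclidean_space set \<Rightarrow> ennreal" where
  "hausdorff_premeasure n \<delta> A =
     (INF U \<in> {U :: nat \<Rightarrow> 'a set.
                 A \<subseteq> (\<Union>i. U i) \<and> (\<forall>i. bounded (U i) \<and> diameter (U i) \<le> \<delta>)}.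
        \<Sum>i. if U i = {} then 0
            else ennreal (unit_ball_vol (real n) * (diameter (U i) / 2) ^ n))"

definition hausdorff_outer :: "nat \<Rightarrow> 'a::euclidean_space set \<Rightarrow> ennreal" where
  "hausdorff_outer n A = (SUP \<delta>\<in>{0<..}. hausdorff_premeasure n \<delta> A)"

definition hausdorff_measure :: "nat \<Rightarrow> 'a::euclidean_space measure" where
  "hausdorff_measure n = measure_of UNIV (sets borel) (hausdorff_outer n)"

definition surface_measure :: "'a::euclidean_space measure" where
  "surface_measure = hausdorff_measure (DIM('a) - 1)"

section \<open>Regular domains\<close>

definition bounded_domain :: "'a::euclidean_space set \<Rightarrow> bool" where
  "bounded_domain \<Omega> \<longleftrightarrow> open \<Omega> \<and> connected \<Omega> \<and> bounded \<Omega> \<and> \<Omega> \<noteq> {}"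

definition horiz :: "'a::euclidean_space \<Rightarrow> 'a \<Rightarrow> 'a" where
  "horiz e x = x - (x \<bullet> e) *\<^sub>R e"

text \<open>In Cartesian coordinates with vertical axis \<open>e\<close>, inside a cylinder around \<open>z\<close> the
  boundary is the graph of \<open>\<phi>\<close> and \<open>\<Omega>\<close> is the region strictly below it.\<close>

definition boundary_graph ::
  "'a::euclidean_space set \<Rightarrow> 'a \<Rightarrow> 'a \<Rightarrow> real \<Rightarrow> real \<Rightarrow> ('a \<Rightarrow> real) \<Rightarrow> bool" where
  "boundary_graph \<Omega> z e r h \<phi> \<longleftrightarrow>
     norm e = 1 \<and> 0 < r \<and> 0 < h \<and>
     (\<forall>x. norm (horiz e (x - z)) < r \<and> \<bar>(x - z) \<bullet> e\<bar> < h \<longrightarrow>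
        (x \<in> \<Omega> \<longleftrightarrow> x \<bullet> e < \<phi> (horiz e x)) \<and>
        (x \<in> frontier \<Omega> \<longleftrightarrow> x \<bullet> e = \<phi> (horiz e x)))"

definition class_C_boundary :: "'a::euclidean_space set \<Rightarrow> bool" where
  "class_C_boundary \<Omega> \<longleftrightarrow>
     (\<forall>z\<in>frontier \<Omega>. \<exists>e r h \<phi>. boundary_graph \<Omega> z e r h \<phi> \<and>
        continuous_on {y. y \<bullet> e = 0 \<and> norm (y - horiz e z) < r} \<phi>)"

definition C1_boundary_graph ::
  "'a::euclidean_space set \<Rightarrow> 'a \<Rightarrow> 'a \<Rightarrow> real \<Rightarrow> real \<Rightarrow> ('a \<Rightarrow> real) \<Rightarrow> bool" where
  "C1_boundary_graph \<Omega> z e r h \<phi> \<longleftrightarrow>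
     boundary_graph \<Omega> z e r h \<phi> \<and>
     Ck_on 1 (\<lambda>x. \<phi> (horiz e x)) {x. norm (horiz e (x - z)) < r}"

definition regular_domain :: "'a::euclidean_space set \<Rightarrow> bool" where
  "regular_domain \<Omega> \<longleftrightarrow>
     bounded_domain \<Omega> \<and> class_C_boundary \<Omega> \<and>
     (AE z in surface_measure. z \<in> frontier \<Omega> \<longrightarrow> (\<exists>e r h \<phi>. C1_boundary_graph \<Omega> z e r h \<phi>))"

text \<open>The normal to the graph \<open>x \<bullet> e = \<phi> (horiz e x)\<close> pointing away from the region below it;
  it does not depend on the chosen \<open>C\<^sup>1\<close> coordinates.\<close>

definition outward_normal :: "'a::euclidean_space set \<Rightarrow> 'a \<Rightarrow> 'a" where
  "outward_normal \<Omega> z =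
     (SOME n. \<exists>e r h \<phi>. C1_boundary_graph \<Omega> z e r h \<phi> \<and>
                n = sgn (e - grad (\<lambda>x. \<phi> (horiz e x)) z))"

text \<open>Both pieces of the boundary are Borel and have positive surface measure; the second one
  is \<open>frontier \<Omega> - D\<close>.\<close>

definition boundary_decomposition :: "'a::euclidean_space set \<Rightarrow> 'a set \<Rightarrow> bool" where
  "boundary_decomposition \<Omega> D \<longleftrightarrow>
     D \<subseteq> frontier \<Omega> \<and> D \<in> sets borel \<and>
     0 < emeasure surface_measure D \<and>
     0 < emeasure surface_measure (frontier \<Omega> - D)"

text \<open>Validity of the Gauss-Green formula, required only for fields that are \<open>C\<^sup>1\<close> up to the
  boundary and whose support avoids \<open>D\<close>, as is the case for fields built from test functions.\<close>

definition green_formula :: "'a::euclidean_space set \<Rightarrow> 'a set \<Rightarrow> bool" where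
  "green_formula \<Omega> D \<longleftrightarrow>
     (\<forall>W F. open W \<and> closure \<Omega> \<subseteq> W \<and> Ck_on 1 F W \<and>
            closure {x\<in>W. F x \<noteq> 0} \<inter> D = {} \<longrightarrow>
        has_bochner_integral surface_measure
          (\<lambda>z. indicator (frontier \<Omega>) z *\<^sub>R (F z \<bullet> outward_normal \<Omega> z))
          (LINT x:\<Omega>|lborel. divergence F x))"

section \<open>Test functions and the fundamental eigenvalue\<close>

text \<open>Restrictions to \<open>\<Omega>\<close> are represented by total functions whose values outside \<open>\<Omega>\<close> are
  irrelevant.\<close>

definition test_functions :: "'a::euclidean_space set \<Rightarrow> 'a set \<Rightarrow> ('a \<Rightarrow> real) set" where
  "test_functions \<Omega> D =
     {\<zeta>. \<exists>\<eta>. (\<forall>k. Ck_on k \<eta> UNIV) \<and> compact (closure {x. \<eta> x \<noteq> 0}) \<and>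
           closure {x. \<eta> x \<noteq> 0} \<inter> D = {} \<and> (\<forall>x\<in>\<Omega>. \<zeta> x = \<eta> x)}"

definition lambda1 :: "'a::euclidean_space set \<Rightarrow> 'a set \<Rightarrow> real \<Rightarrow> ennreal" where
  "lambda1 \<Omega> D p =
     (INF \<zeta> \<in> {\<zeta> \<in> test_functions \<Omega> D. \<exists>x\<in>\<Omega>. \<zeta> x \<noteq> 0}.
        (\<integral>\<^sup>+x\<in>\<Omega>. ennreal (norm (grad \<zeta> x) powr p) \<partial>lborel) /
        (\<integral>\<^sup>+x\<in>\<Omega>. ennreal (\<bar>\<zeta> x\<bar> powr p) \<partial>lborel))"

section \<open>Geometric hypotheses\<close>

definition starlike_wrt_origin :: "'a::euclidean_space set \<Rightarrow> bool" where
  "starlike_wrt_origin N \<longleftrightarrow>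
     (\<forall>u\<in>sphere 0 1. \<forall>s>0. \<forall>t>0. s *\<^sub>R u \<in> N \<and> t *\<^sub>R u \<in> N \<longrightarrow> s = t)"

text \<open>Moving outward along rays from the origin, one passes at almost every point of \<open>N\<close> from
  \<open>\<Omega>\<close> to its exterior. Exceptional null sets are needed since \<open>N\<close> may contain points of its
  edge, where it meets the rest of the boundary.\<close>

definition exterior_away_from_origin :: "'a::euclidean_space set \<Rightarrow> 'a set \<Rightarrow> bool" where
  "exterior_away_from_origin \<Omega> N \<longleftrightarrow>
     (AE z in surface_measure. z \<in> N \<longrightarrow>
        (\<exists>\<epsilon>>0. (\<forall>t. 1 - \<epsilon> < t \<and> t < 1 \<longrightarrow> t *\<^sub>R z \<in> \<Omega>) \<and>
               (\<forall>t. 1 < t \<and> t < 1 + \<epsilon> \<longrightarrow> t *\<^sub>R z \<notin> closure \<Omega>)))"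

section \<open>Averaged distance to the Dirichlet boundary\<close>

definition hits_at :: "'a::euclidean_space set \<Rightarrow> 'a set \<Rightarrow> 'a \<Rightarrow> 'a \<Rightarrow> real \<Rightarrow> bool" where
  "hits_at \<Omega> D x u l \<longleftrightarrow>
     0 < l \<and> (\<forall>t. 0 \<le> t \<and> t < l \<longrightarrow> x + t *\<^sub>R u \<in> \<Omega>) \<and> x + l *\<^sub>R u \<in> D"

definition dirichlet_directions :: "'a::euclidean_space set \<Rightarrow> 'a set \<Rightarrow> 'a \<Rightarrow> 'a set" where
  "dirichlet_directions \<Omega> D x = {u \<in> sphere 0 1. \<exists>l. hits_at \<Omega> D x u l}"

definition dirichlet_distance :: "'a::euclidean_space set \<Rightarrow> 'a set \<Rightarrow> 'a \<Rightarrow> 'a \<Rightarrow> real" where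
  "dirichlet_distance \<Omega> D x u = (THE l. hits_at \<Omega> D x u l)"

text \<open>The quantity \<open>1 / m(x)\<^sup>p\<close>.\<close>

definition inv_mean_distance_pow ::
  "'a::euclidean_space set \<Rightarrow> 'a set \<Rightarrow> real \<Rightarrow> 'a \<Rightarrow> ennreal" where
  "inv_mean_distance_pow \<Omega> D p x =
     (\<integral>\<^sup>+u\<in>dirichlet_directions \<Omega> D x.
         ennreal (1 / dirichlet_distance \<Omega> D x u powr p) \<partial>surface_measure) /
     emeasure (surface_measure :: 'a measure) (sphere 0 1)"

end

(* For F = |zeta|^p |x|^(-p) x, Young's inequality gives, pointwise and with c = (p - d) / p,
     c^(p-1) div F <= |grad zeta|^p - c^p |zeta / x|^p.
   F vanishes on the Dirichlet part, and its flux through the Neumann part is nonnegative because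
   there nu . x >= 0, so integrating with Green's formula gives the Hardy inequality.

   For the bound with m(x), fix a direction u.  Integrating the derivative of |zeta|^p along the
   segment from x to the Dirichlet boundary, of length T(x), bounds |zeta(x)|^p.  Divide by T(x)^p,
   integrate over x, interchange the integrals and translate by s u: since T(y - s u) = T(y) + s,
   the s-integral is that of (T(y) + s)^(-p), namely T(y)^(1-p) / (p - 1).  Young's inequality and
   absorption yield the one-dimensional Hardy inequality in direction u without decomposing Omega
   into lines; averaging over u finishes, as |grad zeta . u| <= |grad zeta|.  The constant obtained,
   ((p - 1) / p)^p, exceeds the stated one by the factor (p - 1)^2, which is at least 1 for p >= 2. *)
theory Submission
  imports Defs
begin

section \<open>Powers of absolute values and gradients\<close>

text \<open>Young's inequality for the exponents \<open>p\<close> and \<open>p / (p - 1)\<close>,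
  multiplied by \<open>p\<close>. In both Hardy inequalities \<open>g\<close> is a gradient term and
  \<open>s\<close> a constant times the modulus of the function over a distance.\<close>

lemma powr_young:
  fixes p s g :: real
  assumes "1 < p" "0 \<le> s" "0 \<le> g"
  shows "p * s powr (p - 1) * g \<le> g powr p + (p - 1) * s powr p"
proof -
  have "g * s powr (p - 1) \<le> g powr p / p + (s powr (p - 1)) powr (p / (p - 1)) / (p / (p - 1))"
    using assms by (intro Youngs_inequality) (auto simp: field_simps)
  also have "(s powr (p - 1)) powr (p / (p - 1)) = s powr p"
    using assms by (simp add: powr_powr)
  finally have "p * (g * s powr (p - 1)) \<le> p * (g powr p / p + s powr p / (p / (p - 1)))"
    using assms by (intro mult_left_mono) auto
  moreover have "p * (g powr p / p + s powr p / (p / (p - 1))) = g powr p + (p - 1) * s powr p"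
    using assms by (simp add: distrib_left)
  ultimately show ?thesis by (simp add: mult_ac)
qed

text \<open>At \<open>y = 0\<close> the difference quotient has modulus
  \<open>\<bar>h\<bar> powr (p - 1)\<close>, which tends to 0 because \<open>1 < p\<close>;
  \<open>sgn 0 = 0\<close> lets one formula cover the zeros as well.\<close>

lemma has_real_derivative_abs_powr:
  fixes p y :: real
  assumes p: "1 < p"
  shows "((\<lambda>y. \<bar>y\<bar> powr p) has_real_derivative p * (sgn y * \<bar>y\<bar> powr (p - 1))) (at y)"
proof (cases "y = 0")
  case True
  have "((\<lambda>h::real. \<bar>h\<bar> powr (p - 1)) \<longlongrightarrow> 0) (at 0)"
  proof -
    have "((\<lambda>h::real. \<bar>h\<bar> powr (p - 1)) \<longlongrightarrow> \<bar>0\<bar> powr (p - 1)) (at 0)"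
      using p by (intro tendsto_powr' tendsto_intros) auto
    then show ?thesis by simp
  qed
  moreover have "\<bar>(\<bar>h\<bar> powr p) / h\<bar> = \<bar>h\<bar> powr (p - 1)" for h :: real
    by (cases "h = 0") (auto simp: powr_diff abs_mult abs_divide)
  ultimately have "((\<lambda>h::real. (\<bar>h\<bar> powr p) / h) \<longlongrightarrow> 0) (at 0)"
    by (subst tendsto_rabs_zero_iff[symmetric]) simp
  then show ?thesis using True by (simp add: DERIV_def)
next
  case False
  have [derivative_intros]: "(abs has_real_derivative sgn y) (at y)"
    using has_derivative_norm[of y] False
    by (simp add: has_field_derivative_def mult.commute[of _ "sgn y"] real_norm_def[abs_def])
  have "((\<lambda>y. \<bar>y\<bar> powr p) has_real_derivative (p * \<bar>y\<bar> powr (p - 1) * sgn y)) (at y)"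
    using False by (auto intro!: derivative_eq_intros simp: powr_diff field_simps)
  then show ?thesis by (simp add: mult_ac)
qed

lemma continuous_sgn_abs_powr:
  fixes q :: real
  assumes "0 < q"
  shows "continuous_on S (\<lambda>y::real. sgn y * \<bar>y\<bar> powr q)"
proof -
  \<comment> \<open>The powers of the positive and of the negative part are both continuous, whereas
    the factor \<open>sgn\<close> jumps at 0.\<close>
  have "(\<lambda>y::real. sgn y * \<bar>y\<bar> powr q) = (\<lambda>y. max y 0 powr q - max (- y) 0 powr q)"
    using assms by (auto simp: fun_eq_iff max_def sgn_if)
  then show ?thesis
    using assms by (simp only:) (auto intro!: continuous_on_diff continuous_on_powr' continuous_on_max
        continuous_on_minus continuous_on_id continuous_on_const)
qed

lemma continuous_abs_powr:
  fixes q :: real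
  assumes "0 < q" "continuous_on S f"
  shows "continuous_on S (\<lambda>x. \<bar>f x :: real\<bar> powr q)"
  using assms by (intro continuous_on_powr') (auto intro!: continuous_intros)

lemma inner_grad:
  assumes "f differentiable at x"
  shows "grad f x \<bullet> v = frechet_derivative f (at x) v"
proof -
  interpret linear "frechet_derivative f (at x)"
    using assms linear_frechet_derivative by blast
  have "frechet_derivative f (at x) v = frechet_derivative f (at x) (\<Sum>b\<in>Basis. (v \<bullet> b) *\<^sub>R b)"
    by (simp add: euclidean_representation)
  also have "\<dots> = grad f x \<bullet> v"
    by (simp add: sum scale grad_def inner_sum_left inner_sum_right inner_commute mult.commute)
  finally show ?thesis by simp
qed

lemma Ck1D:
  assumes "Ck_on 1 f S"
  shows "\<And>x. x \<in> S \<Longrightarrow> f differentiable at x"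
    and "\<And>v. continuous_on S (\<lambda>x. frechet_derivative f (at x) v)"
    and "continuous_on S f"
  using assms by (auto intro!: continuous_at_imp_continuous_on dest: differentiable_imp_continuous_within)

lemma continuous_on_grad: "Ck_on 1 f S \<Longrightarrow> continuous_on S (grad f)"
  unfolding grad_def by (auto intro!: continuous_intros)

section \<open>Hardy's inequality with respect to the origin\<close>

text \<open>In a C^1 chart the height \<open>G t\<close> of \<open>t *\<^sub>R z\<close> over the
  graph vanishes at \<open>t = 1\<close> and is negative just before, so its derivative there,
  \<open>z \<bullet> (e - grad \<psi> z)\<close>, cannot be negative. The normal is a nonnegative
  multiple of \<open>e - grad \<psi> z\<close>.\<close>

lemma outward_normal_inner_nonneg:
  assumes C1: "\<exists>e r h \<phi>. C1_boundary_graph \<Omega> z e r h \<phi>"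
    and z: "z \<in> frontier \<Omega>"
    and eps: "0 < \<epsilon>" "\<And>t. 1 - \<epsilon> < t \<Longrightarrow> t < 1 \<Longrightarrow> t *\<^sub>R z \<in> \<Omega>"
  shows "0 \<le> z \<bullet> outward_normal \<Omega> z"
proof -
  \<comment> \<open>The choice behind \<open>SOME\<close> yields one particular chart, and the
    argument is carried out in that chart.\<close>
  have "\<exists>e r h \<phi>. C1_boundary_graph \<Omega> z e r h \<phi> \<and>
          outward_normal \<Omega> z = sgn (e - grad (\<lambda>x. \<phi> (horiz e x)) z)"
    unfolding outward_normal_def by (rule someI_ex) (use C1 in blast)
  then obtain e r h \<phi> where g: "C1_boundary_graph \<Omega> z e r h \<phi>"
    and n: "outward_normal \<Omega> z = sgn (e - grad (\<lambda>x. \<phi> (horiz e x)) z)" by blast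
  define \<psi> where "\<psi> = (\<lambda>x. \<phi> (horiz e x))"
  have bg: "boundary_graph \<Omega> z e r h \<phi>" and ck: "Ck_on 1 \<psi> {x. norm (horiz e (x - z)) < r}"
    using g by (auto simp: C1_boundary_graph_def \<psi>_def)
  have rh: "0 < r" "0 < h" and
    cyl: "\<And>x. norm (horiz e (x - z)) < r \<Longrightarrow> \<bar>(x - z) \<bullet> e\<bar> < h \<Longrightarrow>
        (x \<in> \<Omega> \<longleftrightarrow> x \<bullet> e < \<psi> x) \<and> (x \<in> frontier \<Omega> \<longleftrightarrow> x \<bullet> e = \<psi> x)"
    using bg by (auto simp: boundary_graph_def \<psi>_def)
  have h0: "horiz e 0 = 0" by (simp add: horiz_def)
  have ze: "z \<bullet> e = \<psi> z" using cyl[of z] z rh by (simp add: h0)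
  have diff: "\<psi> differentiable at z" using Ck1D(1)[OF ck, of z] rh by (simp add: h0)
  define G where "G = (\<lambda>t::real. (t *\<^sub>R z) \<bullet> e - \<psi> (t *\<^sub>R z))"
  have d\<psi>: "(\<psi> has_derivative frechet_derivative \<psi> (at z)) (at (1 *\<^sub>R z))"
    using diff frechet_derivative_works by simp blast
  have dz: "((\<lambda>t::real. t *\<^sub>R z) has_derivative (\<lambda>h. h *\<^sub>R z)) (at 1)"
    by (auto intro!: derivative_eq_intros)
  have dc: "((\<lambda>t::real. \<psi> (t *\<^sub>R z)) has_derivative (\<lambda>h. frechet_derivative \<psi> (at z) (h *\<^sub>R z))) (at 1)"
    by (rule has_derivative_compose[OF dz d\<psi>])
  have lin: "frechet_derivative \<psi> (at z) (h *\<^sub>R z) = h * (z \<bullet> grad \<psi> z)" for h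
    using inner_grad[OF diff, of "h *\<^sub>R z"] by (simp add: inner_commute)
  have "(G has_derivative (\<lambda>h. h * (z \<bullet> (e - grad \<psi> z)))) (at 1)"
    unfolding G_def using dc unfolding lin
    by (auto intro!: derivative_eq_intros simp: inner_diff_right algebra_simps)
  then have dG: "(G has_real_derivative z \<bullet> (e - grad \<psi> z)) (at 1)"
    unfolding has_field_derivative_def
    by (rule has_derivative_eq_rhs) (simp add: fun_eq_iff mult.commute)
  have "0 \<le> z \<bullet> (e - grad \<psi> z)"
  proof (rule ccontr)
    assume "\<not> ?thesis"
    \<comment> \<open>A negative derivative would put the points \<open>t *\<^sub>R z\<close> with
      \<open>t\<close> slightly below 1 above the graph, while the chart, valid as soon as they lie
      in the cylinder, puts them below it.\<close>
    then obtain d where d: "0 < d" "\<And>h. 0 < h \<Longrightarrow> h < d \<Longrightarrow> G 1 < G (1 - h)"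
      using DERIV_neg_dec_left[OF dG] by auto
    have "((\<lambda>t::real. norm (horiz e (t *\<^sub>R z - z))) \<longlongrightarrow> norm (horiz e (1 *\<^sub>R z - z))) (at_left 1)"
      unfolding horiz_def by (intro tendsto_intros)
    then have e1: "\<forall>\<^sub>F t in at_left 1. norm (horiz e (t *\<^sub>R z - z)) < r"
      by (rule order_tendstoD) (simp add: h0 rh)
    have "((\<lambda>t::real. \<bar>(t *\<^sub>R z - z) \<bullet> e\<bar>) \<longlongrightarrow> \<bar>(1 *\<^sub>R z - z) \<bullet> e\<bar>) (at_left 1)"
      by (intro tendsto_intros)
    then have e2: "\<forall>\<^sub>F t in at_left 1. \<bar>(t *\<^sub>R z - z) \<bullet> e\<bar> < h"
      by (rule order_tendstoD) (simp add: rh)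
    have e3: "\<forall>\<^sub>F t in at_left (1::real). t \<in> {max (1 - d) (1 - \<epsilon>)<..<1}"
      using d eps by (intro eventually_at_left_real) auto
    have "\<forall>\<^sub>F t in at_left (1::real). False"
      using e1 e2 e3
    proof eventually_elim
      case (elim t)
      have "G 1 < G t" using d(2)[of "1 - t"] elim by auto
      moreover have "t *\<^sub>R z \<in> \<Omega>" using eps elim by auto
      then have "G t < 0" using cyl[of "t *\<^sub>R z"] elim by (simp add: G_def)
      ultimately show False using ze by (simp add: G_def)
    qed
    then show False by simp
  qed
  then show ?thesis
    unfolding n \<psi>_def[symmetric] by (simp add: sgn_div_norm)
qed

section \<open>The weighted radial field and its divergence\<close>

definition hardy_field :: "real \<Rightarrow> ('a::euclidean_space \<Rightarrow> real) \<Rightarrow> 'a \<Rightarrow> 'a" where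
  "hardy_field p \<eta> x = (\<bar>\<eta> x\<bar> powr p * norm x powr (- p)) *\<^sub>R x"

text \<open>The outcome of the product rule, kept as a closed formula from which both continuity and
  trace can be read off.\<close>

definition hardy_field_deriv :: "real \<Rightarrow> ('a::euclidean_space \<Rightarrow> real) \<Rightarrow> 'a \<Rightarrow> 'a \<Rightarrow> 'a" where
  "hardy_field_deriv p \<eta> x v =
     (- p * \<bar>\<eta> x\<bar> powr p * norm x powr (- p - 2) * (x \<bullet> v) +
      p * (sgn (\<eta> x) * \<bar>\<eta> x\<bar> powr (p - 1)) * norm x powr (- p) * (grad \<eta> x \<bullet> v)) *\<^sub>R x +
     (\<bar>\<eta> x\<bar> powr p * norm x powr (- p)) *\<^sub>R v"

lemma has_derivative_abs_powr:
  assumes "1 < p" "\<eta> differentiable at x"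
  shows "((\<lambda>y. \<bar>\<eta> y\<bar> powr p) has_derivative
    (\<lambda>v. p * (sgn (\<eta> x) * \<bar>\<eta> x\<bar> powr (p - 1)) * (grad \<eta> x \<bullet> v))) (at x)"
proof -
  have "(\<eta> has_derivative (\<lambda>v. grad \<eta> x \<bullet> v)) (at x)"
    using assms(2) by (simp add: inner_grad frechet_derivative_works[symmetric])
  from has_derivative_compose[OF this
      has_real_derivative_abs_powr[OF assms(1), THEN has_field_derivative_imp_has_derivative]]
  show ?thesis by (simp add: mult_ac)
qed

lemma has_derivative_hardy_field:
  assumes "1 < p" "\<eta> differentiable at x" "x \<noteq> 0"
  shows "(hardy_field p \<eta> has_derivative hardy_field_deriv p \<eta> x) (at x)"
proof -
  have "((\<lambda>y::real. y powr (- p)) has_real_derivative - p * norm x powr (- p - 1)) (at (norm x))"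
    using assms(3) by (intro has_real_derivative_powr) simp
  from has_derivative_compose[OF has_derivative_norm[OF assms(3)]
      this[THEN has_field_derivative_imp_has_derivative]]
  have n: "((\<lambda>x. norm x powr (- p)) has_derivative
      (\<lambda>v. - p * norm x powr (- p - 1) * (v \<bullet> sgn x))) (at x)" .
  have "norm x powr (- p - 1) * (v \<bullet> sgn x) = norm x powr (- p - 2) * (x \<bullet> v)" for v
  proof -
    have "norm x powr (- p - 1) = norm x powr (- p - 2) * norm x powr 1"
      by (subst powr_add[symmetric]) (rule arg_cong2[where f = "(powr)"], auto)
    then show ?thesis using assms(3) by (simp add: sgn_div_norm inner_commute)
  qed
  then have n': "((\<lambda>x. norm x powr (- p)) has_derivative
      (\<lambda>v. - p * (norm x powr (- p - 2) * (x \<bullet> v)))) (at x)"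
    using n by (simp add: mult.assoc)
  show ?thesis
    unfolding hardy_field_def[abs_def]
    by (rule has_derivative_eq_rhs,
        (rule derivative_intros n' has_derivative_abs_powr assms)+)
      (simp add: hardy_field_deriv_def fun_eq_iff algebra_simps)
qed

lemma frechet_derivative_hardy_field:
  assumes "1 < p" "\<eta> differentiable at x" "x \<noteq> 0"
  shows "frechet_derivative (hardy_field p \<eta>) (at x) = hardy_field_deriv p \<eta> x"
  using has_derivative_hardy_field[OF assms] frechet_derivative_at by metis

text \<open>The only singularity is the origin, because \<open>1 < p\<close> keeps the derivative
  continuous through the zeros of \<open>\<eta>\<close>. For a domain with the origin in its
  exterior, \<open>- {0}\<close> can serve as the open set \<open>W\<close> of
  \<open>green_formula\<close>.\<close>

lemma Ck_on_hardy_field: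
  fixes \<eta> :: "'a::euclidean_space \<Rightarrow> real"
  assumes p: "1 < p" and \<eta>: "Ck_on 1 \<eta> UNIV"
  shows "Ck_on 1 (hardy_field p \<eta>) (- {0})"
proof -
  have c: "continuous_on (- {0}) \<eta>" "continuous_on (- {0}) (grad \<eta>)"
    using continuous_on_subset[OF Ck1D(3)[OF \<eta>]] continuous_on_subset[OF continuous_on_grad[OF \<eta>]]
    by auto
  have cs: "continuous_on (- {0}) (\<lambda>x. sgn (\<eta> x) * \<bar>\<eta> x\<bar> powr (p - 1))"
    by (rule continuous_on_compose2[OF continuous_sgn_abs_powr[of "p - 1" UNIV] c(1)]) (use p in auto)
  have ca: "continuous_on (- {0}) (\<lambda>x. \<bar>\<eta> x\<bar> powr p)"
    using p by (intro continuous_abs_powr c) auto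
  have cn: "continuous_on (- {0}) (\<lambda>x::'a. norm x powr q)" for q
    by (intro continuous_on_powr continuous_on_norm continuous_on_id continuous_on_const) auto
  have "continuous_on (- {0}) (\<lambda>x. hardy_field_deriv p \<eta> x v)" for v
    unfolding hardy_field_deriv_def
    by (intro continuous_on_add continuous_on_scaleR continuous_on_mult continuous_on_inner
        continuous_on_const continuous_on_id cn cs ca c)
  then have "continuous_on (- {0}) (\<lambda>x. frechet_derivative (hardy_field p \<eta>) (at x) v)" for v
    by (rule continuous_on_eq) (use p frechet_derivative_hardy_field[OF p Ck1D(1)[OF \<eta>]] in auto)
  moreover have "hardy_field p \<eta> differentiable at x" if "x \<noteq> 0" for x
    using has_derivative_hardy_field[OF p Ck1D(1)[OF \<eta>] that] by (auto simp: differentiable_def)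
  ultimately show ?thesis by simp
qed

lemma divergence_hardy_field:
  fixes x :: "'a::euclidean_space"
  assumes "1 < p" "\<eta> differentiable at x" "x \<noteq> 0"
  shows "divergence (hardy_field p \<eta>) x =
    p * (sgn (\<eta> x) * \<bar>\<eta> x\<bar> powr (p - 1)) * norm x powr (- p) * (grad \<eta> x \<bullet> x) -
    (p - real DIM('a)) * (\<bar>\<eta> x\<bar> powr p * norm x powr (- p))"
proof -
  \<comment> \<open>The trace of the derivative: the rank-one terms contribute
    \<open>x \<bullet> x\<close> and \<open>w \<bullet> x\<close>, the multiple of the identity
    contributes the dimension.\<close>
  have "(\<Sum>b\<in>Basis. ((\<alpha> * (x \<bullet> b) + \<beta> * (w \<bullet> b)) *\<^sub>R x + \<gamma> *\<^sub>R b) \<bullet> b) =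
     \<alpha> * (x \<bullet> x) + \<beta> * (w \<bullet> x) + \<gamma> * real DIM('a)" for \<alpha> \<beta> \<gamma> :: real and w :: 'a
    by (simp add: euclidean_inner[of x x] euclidean_inner[of w x] inner_add_left sum.distrib
        sum_distrib_left algebra_simps)
  then have "divergence (hardy_field p \<eta>) x =
      - p * \<bar>\<eta> x\<bar> powr p * norm x powr (- p - 2) * (x \<bullet> x) +
      p * (sgn (\<eta> x) * \<bar>\<eta> x\<bar> powr (p - 1)) * norm x powr (- p) * (grad \<eta> x \<bullet> x) +
      (\<bar>\<eta> x\<bar> powr p * norm x powr (- p)) * real DIM('a)"
    unfolding divergence_def frechet_derivative_hardy_field[OF assms] hardy_field_deriv_def
    by blast
  moreover have "norm x powr (- p - 2) * (x \<bullet> x) = norm x powr (- p)"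
  proof -
    have "norm x powr (- p) = norm x powr (- p - 2) * norm x powr 2"
      unfolding powr_add[symmetric] by simp
    then show ?thesis using assms(3) by (simp add: dot_square_norm)
  qed
  ultimately show ?thesis
    by (simp only: mult.assoc) (simp add: algebra_simps)
qed

text \<open>Put t = |eta| / |x| and G = |grad eta|. Cauchy-Schwarz bounds the divergence by p
  t^(p-1) G - (p-d) t^p. After multiplication by c^(p-1), Young's inequality applies with s = c t,
  and p - d = p c makes the t^p terms add up to (p-1) c^p - p c^p = -c^p.\<close>

lemma divergence_hardy_field_le:
  fixes x :: "'a::euclidean_space" and p :: real
  defines "c \<equiv> (p - real DIM('a)) / p"
  assumes p: "real DIM('a) < p" and "\<eta> differentiable at x" "x \<noteq> 0"
  shows "c powr (p - 1) * divergence (hardy_field p \<eta>) x \<le>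
    norm (grad \<eta> x) powr p - c powr p * \<bar>\<eta> x / norm x\<bar> powr p"
proof -
  have p1: "1 < p" using p DIM_positive[where 'a='a] by linarith
  have c: "0 < c" using p p1 by (simp add: c_def)
  define t where "t = \<bar>\<eta> x\<bar> / norm x"
  define G where "G = norm (grad \<eta> x)"
  have t0: "0 \<le> t" by (simp add: t_def)
  have tp: "t powr q = \<bar>\<eta> x\<bar> powr q * norm x powr (- q)" for q
    by (simp add: t_def powr_divide powr_minus_divide)
  have "sgn (\<eta> x) * (grad \<eta> x \<bullet> x) \<le> \<bar>sgn (\<eta> x) * (grad \<eta> x \<bullet> x)\<bar>" by simp
  also have "\<dots> \<le> 1 * (G * norm x)"
    unfolding abs_mult G_def by (intro mult_mono Cauchy_Schwarz_ineq2) (auto simp: abs_sgn_eq)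
  finally have "sgn (\<eta> x) * (grad \<eta> x \<bullet> x) \<le> G * norm x" by simp
  then have "p * (sgn (\<eta> x) * \<bar>\<eta> x\<bar> powr (p - 1)) * norm x powr (- p) * (grad \<eta> x \<bullet> x)
    \<le> p * \<bar>\<eta> x\<bar> powr (p - 1) * norm x powr (- p) * (G * norm x)"
    using p1 mult_left_mono[of "sgn (\<eta> x) * (grad \<eta> x \<bullet> x)" "G * norm x"
        "p * \<bar>\<eta> x\<bar> powr (p - 1) * norm x powr (- p)"] by (simp add: mult_ac)
  also have "\<dots> = p * t powr (p - 1) * G"
  proof -
    have "norm x powr (- p) * norm x = norm x powr (- (p - 1))"
      using \<open>x \<noteq> 0\<close> powr_add[of "norm x" "- p" 1] by simp
    then show ?thesis by (simp add: tp mult_ac)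
  qed
  finally have "divergence (hardy_field p \<eta>) x \<le> p * t powr (p - 1) * G - (p - real DIM('a)) * t powr p"
    using divergence_hardy_field[OF p1 assms(3,4)] by (simp add: tp)
  then have "c powr (p - 1) * divergence (hardy_field p \<eta>) x \<le>
      c powr (p - 1) * (p * t powr (p - 1) * G - (p - real DIM('a)) * t powr p)"
    by (intro mult_left_mono) auto
  also have "\<dots> = p * (c * t) powr (p - 1) * G - p * c powr p * t powr p"
  proof -
    have "c powr p = c powr (p - 1) * c" using c powr_add[of c "p - 1" 1] by simp
    then have "p * c powr p = c powr (p - 1) * (p - real DIM('a))"
      using p1 by (simp add: c_def)
    then have "p * c powr p * t powr p = c powr (p - 1) * ((p - real DIM('a)) * t powr p)" by simp
    moreover have "p * (c * t) powr (p - 1) * G = c powr (p - 1) * (p * t powr (p - 1) * G)"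
      using c t0 by (simp add: powr_mult)
    ultimately show ?thesis by (simp only: right_diff_distrib)
  qed
  also have "\<dots> \<le> G powr p + (p - 1) * (c * t) powr p - p * c powr p * t powr p"
    using powr_young[OF p1, of "c * t" G] c t0 by (simp add: G_def)
  also have "\<dots> = G powr p - c powr p * t powr p"
    using c t0 by (simp add: powr_mult algebra_simps)
  finally show ?thesis by (simp add: G_def t_def)
qed

section \<open>Integration with Green's formula\<close>

lemma set_integrable_continuous_closure:
  fixes f :: "'a::euclidean_space \<Rightarrow> real"
  assumes "open \<Omega>" "bounded \<Omega>" "continuous_on (closure \<Omega>) f"
  shows "set_integrable lborel \<Omega> f"
proof -
  have "set_integrable lborel (closure \<Omega>) f"
    unfolding set_integrable_def using assms by (intro borel_integrable_compact) auto
  then show ?thesis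
    by (rule set_integrable_subset) (use assms closure_subset in auto)
qed

text \<open>Stated for a globally C^1 function because Green's formula involves values on and beyond
  the boundary, where a member of \<open>test_functions\<close> is arbitrary.\<close>

lemma hardy_inequality_origin:
  fixes \<Omega> D :: "'a::euclidean_space set" and p :: real
  defines "c \<equiv> (p - real DIM('a)) / p"
  assumes p: "real DIM('a) < p"
    and dom: "open \<Omega>" "bounded \<Omega>"
    and green: "green_formula \<Omega> D"
    and origin: "0 \<notin> closure \<Omega>"
    and normal: "AE z in surface_measure. z \<in> frontier \<Omega> - D \<longrightarrow> 0 \<le> z \<bullet> outward_normal \<Omega> z"
    and \<eta>: "Ck_on 1 \<eta> UNIV" "closure {x. \<eta> x \<noteq> 0} \<inter> D = {}"
  shows "ennreal (c powr p) * (\<integral>\<^sup>+x\<in>\<Omega>. ennreal (\<bar>\<eta> x / norm x\<bar> powr p) \<partial>lborel)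
    \<le> (\<integral>\<^sup>+x\<in>\<Omega>. ennreal (norm (grad \<eta> x) powr p) \<partial>lborel)"
proof -
  let ?F = "hardy_field p \<eta>"
  have p1: "1 < p" using p DIM_positive[where 'a='a] by linarith
  have cl: "closure \<Omega> \<subseteq> - {0}" using origin by auto
  \<comment> \<open>The closure is taken in the whole space, but the field vanishes wherever
    \<open>\<eta>\<close> does, so its support still avoids \<open>D\<close>.\<close>
  have "closure {x \<in> - {0}. ?F x \<noteq> 0} \<subseteq> closure {x. \<eta> x \<noteq> 0}"
    by (intro closure_mono) (auto simp: hardy_field_def)
  then have "closure {x \<in> - {0}. ?F x \<noteq> 0} \<inter> D = {}"
    using \<eta>(2) by blast
  then have bi: "has_bochner_integral surface_measure
      (\<lambda>z. indicator (frontier \<Omega>) z *\<^sub>R (?F z \<bullet> outward_normal \<Omega> z))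
      (LINT x:\<Omega>|lborel. divergence ?F x)"
    using green[unfolded green_formula_def, rule_format, of "- {0}" ?F]
      Ck_on_hardy_field[OF p1 \<eta>(1)] cl by auto
  have zero: "\<eta> z = 0" if "z \<in> D" for z
    using that \<eta>(2) closure_subset[of "{x. \<eta> x \<noteq> 0}"] by blast
  \<comment> \<open>On \<open>D\<close> the integrand is zero because \<open>\<eta>\<close> vanishes
    there; on the rest of the frontier it is a nonnegative multiple of
    \<open>z \<bullet> outward_normal \<Omega> z\<close>.\<close>
  have "0 \<le> (LINT z|surface_measure. indicator (frontier \<Omega>) z *\<^sub>R (?F z \<bullet> outward_normal \<Omega> z))"
  proof (rule integral_nonneg_AE)
    show "AE z in surface_measure. 0 \<le> indicator (frontier \<Omega>) z *\<^sub>R (?F z \<bullet> outward_normal \<Omega> z)"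
      using normal
    proof eventually_elim
      case (elim z)
      then show ?case
        using p1 by (cases "z \<in> D") (auto simp: hardy_field_def zero indicator_def)
    qed
  qed
  then have div0: "0 \<le> (LINT x:\<Omega>|lborel. divergence ?F x)"
    using bi by (simp add: has_bochner_integral_iff)
  have c\<eta>: "continuous_on (closure \<Omega>) \<eta>" "continuous_on (closure \<Omega>) (grad \<eta>)"
    using continuous_on_subset[OF Ck1D(3)[OF \<eta>(1)]]
      continuous_on_subset[OF continuous_on_grad[OF \<eta>(1)]] by auto
  have i1: "set_integrable lborel \<Omega> (\<lambda>x. norm (grad \<eta> x) powr p)"
    using p1 by (intro set_integrable_continuous_closure dom continuous_on_powr' continuous_intros c\<eta>) auto
  have i2: "set_integrable lborel \<Omega> (\<lambda>x. \<bar>\<eta> x / norm x\<bar> powr p)"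
    using p1 origin by (intro set_integrable_continuous_closure dom continuous_abs_powr continuous_intros c\<eta>) auto
  have i3: "set_integrable lborel \<Omega> (divergence ?F)"
  proof (intro set_integrable_continuous_closure dom)
    have "continuous_on (- {0}) (divergence ?F)"
      unfolding divergence_def using Ck1D(2)[OF Ck_on_hardy_field[OF p1 \<eta>(1)]]
      by (intro continuous_intros) auto
    then show "continuous_on (closure \<Omega>) (divergence ?F)"
      by (rule continuous_on_subset) (rule cl)
  qed
  have "0 \<le> c powr (p - 1) * (LINT x:\<Omega>|lborel. divergence ?F x)"
    using div0 by simp
  also have "\<dots> = (LINT x:\<Omega>|lborel. c powr (p - 1) * divergence ?F x)" by simp
  also have "\<dots> \<le> (LINT x:\<Omega>|lborel. norm (grad \<eta> x) powr p - c powr p * \<bar>\<eta> x / norm x\<bar> powr p)"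
  proof (rule set_integral_mono)
    fix x assume "x \<in> \<Omega>"
    then have "x \<noteq> 0" using origin closure_subset by blast
    then show "c powr (p - 1) * divergence ?F x \<le> norm (grad \<eta> x) powr p - c powr p * \<bar>\<eta> x / norm x\<bar> powr p"
      unfolding c_def using divergence_hardy_field_le[OF p Ck1D(1)[OF \<eta>(1)]] by auto
  qed (use i1 i2 i3 in auto)
  also have "\<dots> = (LINT x:\<Omega>|lborel. norm (grad \<eta> x) powr p) - c powr p * (LINT x:\<Omega>|lborel. \<bar>\<eta> x / norm x\<bar> powr p)"
    using i1 i2 by (subst set_integral_diff) auto
  finally have le: "c powr p * (LINT x:\<Omega>|lborel. \<bar>\<eta> x / norm x\<bar> powr p) \<le>
      (LINT x:\<Omega>|lborel. norm (grad \<eta> x) powr p)" by simp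
  \<comment> \<open>Converts the Lebesgue integrals, which allowed the subtraction above, into the
    nonnegative integrals of the conclusion.\<close>
  have nn: "(\<integral>\<^sup>+x\<in>\<Omega>. ennreal (f x) \<partial>lborel) = ennreal (LINT x:\<Omega>|lborel. f x)"
    if "set_integrable lborel \<Omega> f" "\<And>x. 0 \<le> f x" for f
  proof -
    have "ennreal (LINT x:\<Omega>|lborel. f x) = (\<integral>\<^sup>+x. ennreal (indicator \<Omega> x *\<^sub>R f x) \<partial>lborel)"
      unfolding set_lebesgue_integral_def using that
      by (intro nn_integral_eq_integral[symmetric]) (auto simp: set_integrable_def)
    also have "\<dots> = (\<integral>\<^sup>+x\<in>\<Omega>. ennreal (f x) \<partial>lborel)"
      by (intro nn_integral_cong) (simp split: split_indicator)
    finally show ?thesis by simp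
  qed
  show ?thesis
    using le nn[OF i1] nn[OF i2] by (simp add: ennreal_mult'[symmetric] ennreal_leI)
qed

section \<open>Exit times and measurability of the Dirichlet distance\<close>

text \<open>The time of leaving through any part of the boundary. Unlike the Dirichlet distance it
  is meaningful for every starting point in \<open>\<Omega>\<close> and every unit direction, and
  exceeding a given value is an open condition; measurability is derived from it.\<close>

definition exit_time :: "'a::euclidean_space set \<Rightarrow> 'a \<Rightarrow> 'a \<Rightarrow> real" where
  "exit_time \<Omega> x u = Inf {t. 0 \<le> t \<and> x + t *\<^sub>R u \<notin> \<Omega>}"

context
  fixes \<Omega> D :: "'a::euclidean_space set"
  assumes dom: "open \<Omega>" "bounded \<Omega>" and disj: "D \<inter> \<Omega> = {}"
begin

text \<open>At the smaller of two distinct lengths the ray would be in \<open>D\<close> and in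
  \<open>\<Omega>\<close> at once.\<close>

lemma hits_at_unique:
  assumes "hits_at \<Omega> D x u l" "hits_at \<Omega> D x u l'"
  shows "l = l'"
proof -
  have "\<not> l < l'" "\<not> l' < l"
    using assms disj unfolding hits_at_def by (auto simp: disjoint_iff less_imp_le)
  then show ?thesis by simp
qed

lemma dirichlet_distance_eq: "hits_at \<Omega> D x u l \<Longrightarrow> dirichlet_distance \<Omega> D x u = l"
  unfolding dirichlet_distance_def using hits_at_unique by blast

lemma hits_at_dirichlet_distance:
  "u \<in> dirichlet_directions \<Omega> D x \<Longrightarrow> hits_at \<Omega> D x u (dirichlet_distance \<Omega> D x u)"
  unfolding dirichlet_directions_def using dirichlet_distance_eq by auto

text \<open>The times outside \<open>\<Omega>\<close> form a nonempty set, as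
  \<open>\<Omega>\<close> is bounded, and a closed one, as \<open>\<Omega>\<close> is open; so the
  infimum is attained.\<close>

lemma exit_time_less_iff:
  assumes x: "x \<in> \<Omega>" and u: "norm u = 1" and c: "0 \<le> c"
  shows "c < exit_time \<Omega> x u \<longleftrightarrow> (\<forall>t\<in>{0..c}. x + t *\<^sub>R u \<in> \<Omega>)"
    and "x + exit_time \<Omega> x u *\<^sub>R u \<notin> \<Omega>"
proof -
  let ?S = "{t. 0 \<le> t \<and> x + t *\<^sub>R u \<notin> \<Omega>}"
  have bdd: "bdd_below ?S" by (rule bdd_belowI[of _ 0]) auto
  obtain B where B: "\<And>y. y \<in> \<Omega> \<Longrightarrow> norm y \<le> B"
    using dom(2) by (auto simp: bounded_iff)
  \<comment> \<open>By the triangle inequality this time leads to a point of norm at least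
    \<open>B + 1\<close>.\<close>
  define t where "t = B + norm x + 1"
  have t0: "0 \<le> t" using order_trans[OF norm_ge_zero B[OF x]] by (simp add: t_def)
  have "t = norm (t *\<^sub>R u)" using t0 u by simp
  also have "\<dots> \<le> norm (x + t *\<^sub>R u) + norm x" using norm_triangle_ineq4[of "x + t *\<^sub>R u" x] by simp
  finally have "x + t *\<^sub>R u \<notin> \<Omega>" using B by (fastforce simp: t_def)
  with t0 have ne: "?S \<noteq> {}" by auto
  have "closed ({0..} \<inter> (\<lambda>t. x + t *\<^sub>R u) -` (- \<Omega>))"
    using dom(1) by (intro closed_Int closed_vimage continuous_intros) auto
  also have "{0..} \<inter> (\<lambda>t. x + t *\<^sub>R u) -` (- \<Omega>) = ?S" by auto
  finally have "Inf ?S \<in> ?S" by (rule closed_contains_Inf[OF ne bdd])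
  then show out: "x + exit_time \<Omega> x u *\<^sub>R u \<notin> \<Omega>" and "c < exit_time \<Omega> x u \<longleftrightarrow> (\<forall>t\<in>{0..c}. x + t *\<^sub>R u \<in> \<Omega>)"
    unfolding exit_time_def using cInf_lower[OF _ bdd] by force+
qed

text \<open>Before the hit the ray is in \<open>\<Omega>\<close>, and at the hit it is in
  \<open>D\<close>, hence outside; the only candidate for \<open>l\<close> is the exit time.\<close>

lemma hits_at_iff_exit_time:
  assumes "norm u = 1"
  shows "hits_at \<Omega> D x u l \<longleftrightarrow> x \<in> \<Omega> \<and> l = exit_time \<Omega> x u \<and> x + l *\<^sub>R u \<in> D"
proof (cases "x \<in> \<Omega>")
  case True
  note e = exit_time_less_iff[OF True assms]
  show ?thesis
  proof
    assume h: "hits_at \<Omega> D x u l"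
    then have l: "0 < l" "\<And>t. 0 \<le> t \<Longrightarrow> t < l \<Longrightarrow> x + t *\<^sub>R u \<in> \<Omega>" "x + l *\<^sub>R u \<in> D"
      by (auto simp: hits_at_def)
    have "0 < exit_time \<Omega> x u" using e(1)[of 0] True by simp
    then have "\<not> exit_time \<Omega> x u < l" using l(2) e(2)[of 0] by force
    moreover have "\<not> l < exit_time \<Omega> x u" using e(1)[of l] l disj by (force simp: disjoint_iff)
    ultimately show "x \<in> \<Omega> \<and> l = exit_time \<Omega> x u \<and> x + l *\<^sub>R u \<in> D"
      using l True by auto
  next
    assume "x \<in> \<Omega> \<and> l = exit_time \<Omega> x u \<and> x + l *\<^sub>R u \<in> D"
    then show "hits_at \<Omega> D x u l"
      using e(1)[of 0] e(1) True by (force simp: hits_at_def)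
  qed
next
  case False
  have "hits_at \<Omega> D x u l \<Longrightarrow> x + 0 *\<^sub>R u \<in> \<Omega>" unfolding hits_at_def by blast
  with False show ?thesis by auto
qed

text \<open>Measurability is joint in point and direction, as Tonelli's theorem later demands. The
  exit time is treated through its superlevel sets; a direction is then admissible iff the exit
  point, a Borel function of the pair, lies in \<open>D\<close>.\<close>

lemma
  assumes D: "D \<in> sets borel"
  shows dirichlet_directions_borel:
      "{q. snd q \<in> dirichlet_directions \<Omega> D (fst q)} \<in> sets borel" (is "?H \<in> _")
    and dirichlet_distance_borel_measurable:
      "(\<lambda>q. if snd q \<in> dirichlet_directions \<Omega> D (fst q)
         then dirichlet_distance \<Omega> D (fst q) (snd q) else 0) \<in> borel_measurable borel" (is "?d \<in> _")
proof -
  define B where "B = (\<Omega> \<times> sphere 0 1 :: ('a \<times> 'a) set)"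
  have B: "B \<in> sets borel"
    unfolding B_def borel_prod[symmetric] using dom(1) by (intro pair_measureI) auto
  define L where "L = (\<lambda>q. if q \<in> B then exit_time \<Omega> (fst q) (snd q) else 0)"
  \<comment> \<open>The complement is the projection of a closed set along the compact interval
    \<open>{0..c}\<close>, hence closed.\<close>
  have op: "open {q :: 'a \<times> 'a. \<forall>t\<in>{0..c}. fst q + t *\<^sub>R snd q \<in> \<Omega>}" for c
  proof -
    have "closed {q. \<exists>t. t \<in> {0..c} \<and> (t, q) \<in> (\<lambda>r. fst (snd r) + fst r *\<^sub>R snd (snd r)) -` (- \<Omega>)}"
      using dom(1) by (intro closed_compact_projection closed_vimage continuous_intros) auto
    then have "open (- {q. \<exists>t. t \<in> {0..c} \<and> (t, q) \<in> (\<lambda>r. fst (snd r) + fst r *\<^sub>R snd (snd r)) -` (- \<Omega>)})"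
      by (rule open_Compl)
    then show ?thesis by (rule back_subst[where P = "open"]) auto
  qed
  have L: "L \<in> borel_measurable borel"
  proof (subst borel_measurable_iff_greater, intro allI)
    fix c :: real
    \<comment> \<open>For negative \<open>c\<close> the set is everything, since \<open>L\<close> is
      positive on \<open>B\<close> and 0 elsewhere.\<close>
    have "{w \<in> space borel. c < L w} =
        (if 0 \<le> c then B \<inter> {q. \<forall>t\<in>{0..c}. fst q + t *\<^sub>R snd q \<in> \<Omega>} else UNIV)"
    proof (cases "0 \<le> c")
      case True
      then show ?thesis
        using exit_time_less_iff(1)[OF _ _ True] by (auto simp: L_def B_def)
    next
      case False
      have "0 < exit_time \<Omega> x u" if "x \<in> \<Omega>" "norm u = 1" for x u
        using that exit_time_less_iff(1)[OF that, of 0] by simp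
      then have "c < L q" for q
        using False by (force simp: L_def B_def)
      then show ?thesis using False by auto
    qed
    then show "{w \<in> space borel. c < L w} \<in> sets borel"
      using B op by auto
  qed
  have H: "?H = B \<inter> (\<lambda>q. fst q + L q *\<^sub>R snd q) -` D"
    by (auto simp: B_def L_def dirichlet_directions_def hits_at_iff_exit_time)
  have "(\<lambda>q. fst q + L q *\<^sub>R snd q) \<in> borel_measurable borel"
    using L by (intro borel_measurable_add borel_measurable_scaleR) (auto intro!: borel_measurable_continuous_onI continuous_intros)
  from measurable_sets[OF this D] have "(\<lambda>q. fst q + L q *\<^sub>R snd q) -` D \<in> sets borel" by simp
  then show Hb: "?H \<in> sets borel" unfolding H using B by blast
  have "?d = (\<lambda>q. if q \<in> ?H then L q else 0)"
  proof
    fix q :: "'a \<times> 'a"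
    show "?d q = (if q \<in> ?H then L q else 0)"
    proof (cases "q \<in> ?H")
      case True
      then have u: "norm (snd q) = 1" by (auto simp: dirichlet_directions_def)
      have "hits_at \<Omega> D (fst q) (snd q) (?d q)"
        using True hits_at_dirichlet_distance by auto
      then show ?thesis using True u hits_at_iff_exit_time[OF u] by (auto simp: L_def B_def mem_Times_iff)
    qed auto
  qed
  then show "?d \<in> borel_measurable borel"
    using L Hb by (simp only:) (intro measurable_If_set; simp)
qed

end

section \<open>Hardy's inequality along a fixed direction\<close>

lemma nn_integral_shifted_powr:
  fixes T p :: real
  assumes "1 < p" "0 < T"
  shows "(\<integral>\<^sup>+s. ennreal ((T + s) powr (- p)) * indicator {0..} s \<partial>lborel) = ennreal (T powr (1 - p) / (p - 1))"
proof -
  define F where "F = (\<lambda>s. - ((T + s) powr (1 - p) / (p - 1)))"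
  have "filterlim (\<lambda>s. T + s) at_top at_top"
    by (rule filterlim_tendsto_add_at_top[OF tendsto_const filterlim_ident])
  then have "((\<lambda>s. (T + s) powr (1 - p)) \<longlongrightarrow> 0) at_top"
    using assms by (intro tendsto_neg_powr) auto
  then have "((\<lambda>s. - ((T + s) powr (1 - p) / (p - 1))) \<longlongrightarrow> - (0 / (p - 1))) at_top"
    using assms by (intro tendsto_intros) auto
  then have lim: "(F \<longlongrightarrow> 0) at_top" by (simp add: F_def)
  have "(\<integral>\<^sup>+s. ennreal ((T + s) powr (- p)) * indicator {0..} s \<partial>lborel) = ennreal (0 - F 0)"
  proof (rule nn_integral_FTC_atLeast[OF _ _ _ lim])
    fix s :: real assume "0 \<le> s"
    have "((\<lambda>s. T + s) has_real_derivative 1) (at s)" by (auto intro!: derivative_eq_intros)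
    from DERIV_chain2[OF has_real_derivative_powr this, of "1 - p"] \<open>0 \<le> s\<close> assms
    have "((\<lambda>s. (T + s) powr (1 - p)) has_real_derivative (1 - p) * (T + s) powr (- p)) (at s)" by simp
    note d = DERIV_minus[OF DERIV_cdivide[OF this, of "p - 1"]]
    have "- ((1 - p) * (T + s) powr - p / (p - 1)) = (T + s) powr (- p)"
      using assms by (simp add: field_simps)
    then show "(F has_real_derivative (T + s) powr (- p)) (at s)"
      using d by (simp add: F_def)
  qed auto
  then show ?thesis by (simp add: F_def)
qed

lemma nn_integral_lborel_translate:
  fixes c :: "'a::euclidean_space"
  assumes [measurable]: "f \<in> borel_measurable borel"
  shows "(\<integral>\<^sup>+x. f (x - c) \<partial>lborel) = (\<integral>\<^sup>+x. f x \<partial>lborel)"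
proof -
  have "(\<integral>\<^sup>+x. f x \<partial>lborel) = (\<integral>\<^sup>+x. f x \<partial>distr lborel borel ((+) (- c)))"
    by (simp add: lborel_distr_plus)
  also have "\<dots> = (\<integral>\<^sup>+x. f (- c + x) \<partial>lborel)"
    by (subst nn_integral_distr) auto
  finally show ?thesis by simp
qed

lemma has_real_derivative_along_line:
  assumes "\<eta> differentiable at (x + s *\<^sub>R u)"
  shows "((\<lambda>s. \<eta> (x + s *\<^sub>R u)) has_real_derivative grad \<eta> (x + s *\<^sub>R u) \<bullet> u) (at s)"
proof -
  have "(\<eta> has_derivative (\<lambda>v. grad \<eta> (x + s *\<^sub>R u) \<bullet> v)) (at (x + s *\<^sub>R u))"
    using assms by (simp add: inner_grad frechet_derivative_works[symmetric])
  moreover have "((\<lambda>s. x + s *\<^sub>R u) has_derivative (\<lambda>h. h *\<^sub>R u)) (at s)"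
    by (auto intro!: derivative_eq_intros)
  ultimately have "((\<lambda>s. \<eta> (x + s *\<^sub>R u)) has_derivative (\<lambda>h. grad \<eta> (x + s *\<^sub>R u) \<bullet> (h *\<^sub>R u))) (at s)"
    using has_derivative_compose by blast
  then show ?thesis
    unfolding has_field_derivative_def
    by (rule has_derivative_eq_rhs) (simp add: fun_eq_iff mult.commute)
qed

text \<open>The fundamental theorem of calculus for |eta|^p on the segment, whose end value is zero.
  The interval is half-open to match the range of shifts in \<open>hits_at_shift\<close>.\<close>

lemma abs_powr_le_line_integral:
  fixes p :: real
  assumes p: "1 < p" and \<eta>: "Ck_on 1 \<eta> UNIV" and T: "0 \<le> T" "\<eta> (x + T *\<^sub>R u) = 0"
  shows "ennreal (\<bar>\<eta> x\<bar> powr p) \<le>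
    (\<integral>\<^sup>+s. ennreal (p * \<bar>\<eta> (x + s *\<^sub>R u)\<bar> powr (p - 1) * \<bar>grad \<eta> (x + s *\<^sub>R u) \<bullet> u\<bar>) *
      indicator {0..<T} s \<partial>lborel)"
proof -
  let ?l = "\<lambda>s. x + s *\<^sub>R u"
  define f where "f = (\<lambda>s. \<bar>\<eta> (?l s)\<bar> powr p)"
  define f' where "f' = (\<lambda>s. p * (sgn (\<eta> (?l s)) * \<bar>\<eta> (?l s)\<bar> powr (p - 1)) * (grad \<eta> (?l s) \<bullet> u))"
  have c\<eta>: "continuous_on UNIV (\<lambda>s. \<eta> (?l s))" "continuous_on UNIV (\<lambda>s. grad \<eta> (?l s))"
    by (rule continuous_on_compose2[OF Ck1D(3)[OF \<eta>]] continuous_on_compose2[OF continuous_on_grad[OF \<eta>]];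
        auto intro!: continuous_intros)+
  have "(f has_real_derivative f' s) (at s)" for s
    using DERIV_chain2[OF has_real_derivative_abs_powr[OF p] has_real_derivative_along_line[OF Ck1D(1)[OF \<eta>]]]
    by (simp add: f_def f'_def)
  then have d: "(f has_vector_derivative f' s) (at s within {0..T})" for s
    by (simp add: has_real_derivative_iff_has_vector_derivative has_vector_derivative_at_within)
  have "continuous_on UNIV (\<lambda>s. sgn (\<eta> (?l s)) * \<bar>\<eta> (?l s)\<bar> powr (p - 1))"
    by (rule continuous_on_compose2[OF continuous_sgn_abs_powr[of "p - 1" UNIV] c\<eta>(1)]) (use p in auto)
  from continuous_on_mult[OF continuous_on_mult[OF continuous_on_const this]
      continuous_on_inner[OF c\<eta>(2) continuous_on_const]]
  have "continuous_on UNIV f'" unfolding f'_def .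
  then have c: "continuous_on {0..T} f'" by (rule continuous_on_subset) simp
  have b: "has_bochner_integral lborel (\<lambda>s. indicator {0..T} s *\<^sub>R f' s) (f T - f 0)"
    by (rule has_bochner_integral_FTC_Icc[OF T(1) d c])
  have "ennreal (norm (f T - f 0)) \<le> (\<integral>\<^sup>+s. ennreal (norm (indicator {0..T} s *\<^sub>R f' s)) \<partial>lborel)"
    using integral_norm_bound_ennreal[of lborel "\<lambda>s. indicator {0..T} s *\<^sub>R f' s"] b
    by (simp add: has_bochner_integral_iff)
  also have "norm (f T - f 0) = \<bar>\<eta> x\<bar> powr p" using T(2) by (simp add: f_def)
  also have "(\<integral>\<^sup>+s. ennreal (norm (indicator {0..T} s *\<^sub>R f' s)) \<partial>lborel) \<le> (\<integral>\<^sup>+s. ennreal (p * \<bar>\<eta> (?l s)\<bar> powr (p - 1) * \<bar>grad \<eta> (?l s) \<bullet> u\<bar>) * indicator {0..<T} s \<partial>lborel)"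
  proof (intro nn_integral_mono)
    fix s :: real
    show "ennreal (norm (indicator {0..T} s *\<^sub>R f' s)) \<le>
        ennreal (p * \<bar>\<eta> (?l s)\<bar> powr (p - 1) * \<bar>grad \<eta> (?l s) \<bullet> u\<bar>) * indicator {0..<T} s"
    proof (cases "s = T")
      case True
      then show ?thesis using T by (simp add: f'_def)
    next
      case False
      then show ?thesis using p
        by (auto simp: f'_def abs_mult abs_sgn_eq indicator_def intro!: ennreal_leI)
    qed
  qed
  finally show ?thesis .
qed

text \<open>With \<open>x = y - s *\<^sub>R u\<close> this becomes T(x) = T(y) + s, the identity
  that turns the weight into a shifted power after translation.\<close>

lemma hits_at_shift:
  assumes "hits_at \<Omega> D x u l" "0 \<le> s" "s < l"
  shows "hits_at \<Omega> D (x + s *\<^sub>R u) u (l - s)"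
proof -
  have "x + s *\<^sub>R u + t *\<^sub>R u = x + (s + t) *\<^sub>R u" for t
    by (simp add: algebra_simps)
  then show ?thesis using assms unfolding hits_at_def by (simp add: add.assoc)
qed

text \<open>Write A for the weighted integral and B for the gradient integral. Tonelli's theorem and
  translation bound A by the integral of k T^(1-p) / (p-1) over E; Young's inequality turns this
  into p c^p A <= B + (p-1) c^p A, and finiteness of A permits subtraction.\<close>

lemma directional_hardy:
  fixes \<Omega> D :: "'a::euclidean_space set" and p :: real and u :: 'a
  defines "E \<equiv> {x. u \<in> dirichlet_directions \<Omega> D x}"
    and "c \<equiv> (p - 1) / p"
  assumes dom: "open \<Omega>" "bounded \<Omega>" and disj: "D \<inter> \<Omega> = {}" and D: "D \<in> sets borel"
    and p: "1 < p" and u: "norm u = 1"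
    and \<eta>: "Ck_on 1 \<eta> UNIV" and zero: "\<And>x. x \<in> D \<Longrightarrow> \<eta> x = 0"
  shows "ennreal (c powr p) *
      (\<integral>\<^sup>+x. ennreal (\<bar>\<eta> x\<bar> powr p / dirichlet_distance \<Omega> D x u powr p) * indicator E x \<partial>lborel)
    \<le> (\<integral>\<^sup>+x\<in>\<Omega>. ennreal (\<bar>grad \<eta> x \<bullet> u\<bar> powr p) \<partial>lborel)"
proof -
  \<comment> \<open>The value 0 off \<open>E\<close> makes \<open>T\<close> total; every integrand
    containing \<open>T\<close> carries the indicator of \<open>E\<close>.\<close>
  define T where "T = (\<lambda>x. if x \<in> E then dirichlet_distance \<Omega> D x u else 0)"
  \<comment> \<open>An upper bound for the modulus of the derivative of |eta|^p in direction
    \<open>u\<close>.\<close>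
  define k where "k = (\<lambda>x. p * \<bar>\<eta> x\<bar> powr (p - 1) * \<bar>grad \<eta> x \<bullet> u\<bar>)"
  have hits: "hits_at \<Omega> D x u (T x)" if "x \<in> E" for x
    using that hits_at_dirichlet_distance[OF dom disj] by (auto simp: E_def T_def)
  have hitsD: "x \<in> E" "T x = l" if "hits_at \<Omega> D x u l" for x l
  proof -
    show "x \<in> E" using that u by (auto simp: E_def dirichlet_directions_def)
    from hits[OF this] that show "T x = l" using hits_at_unique[OF dom disj] by blast
  qed
  have Tpos: "0 < T x" "x \<in> \<Omega>" "\<eta> (x + T x *\<^sub>R u) = 0" if "x \<in> E" for x
  proof -
    show T: "0 < T x" and "\<eta> (x + T x *\<^sub>R u) = 0"
      using hits[OF that] zero by (auto simp: hits_at_def)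
    have "x + 0 *\<^sub>R u \<in> \<Omega>" using hits[OF that] T unfolding hits_at_def by blast
    then show "x \<in> \<Omega>" by simp
  qed
  have [measurable]: "(\<lambda>x. (x, u)) \<in> borel_measurable borel"
    by (intro borel_measurable_continuous_onI continuous_intros)
  have [measurable]: "E \<in> sets borel"
    using measurable_sets[OF \<open>(\<lambda>x. (x, u)) \<in> _\<close> dirichlet_directions_borel[OF dom disj D]]
    by (simp add: E_def vimage_def)
  have [measurable]: "T \<in> borel_measurable borel"
    using measurable_compose[OF \<open>(\<lambda>x. (x, u)) \<in> _\<close> dirichlet_distance_borel_measurable[OF dom disj D]]
    unfolding T_def E_def fst_conv snd_conv by simp
  have [measurable]: "\<eta> \<in> borel_measurable borel" "grad \<eta> \<in> borel_measurable borel"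
    by (intro borel_measurable_continuous_onI Ck1D(3)[OF \<eta>] continuous_on_grad[OF \<eta>])+
  have [measurable]: "k \<in> borel_measurable borel" unfolding k_def by measurable
  have [measurable]: "\<Omega> \<in> sets borel" using dom by simp
  have k0: "0 \<le> k x" for x using p by (simp add: k_def)

  define A where "A = (\<integral>\<^sup>+x. ennreal (\<bar>\<eta> x\<bar> powr p * T x powr (- p)) * indicator E x \<partial>lborel)"
  have A_eq: "(\<integral>\<^sup>+x. ennreal (\<bar>\<eta> x\<bar> powr p / dirichlet_distance \<Omega> D x u powr p) * indicator E x \<partial>lborel) = A"
    unfolding A_def by (intro nn_integral_cong) (auto simp: T_def powr_minus_divide split: split_indicator)

  define \<Phi> where "\<Phi> = (\<lambda>x s. indicator E x * ennreal (T x powr (- p)) *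
      (ennreal (k (x + s *\<^sub>R u)) * indicator {0..<T x} s))"
  \<comment> \<open>The interval \<open>{0..<T x}\<close> varies with \<open>x\<close>; written as a
    conditional, its indicator is visibly jointly measurable.\<close>
  have "\<Phi> = (\<lambda>x s. indicator E x * ennreal (T x powr (- p)) *
      (ennreal (k (x + s *\<^sub>R u)) * (if 0 \<le> s \<and> s < T x then 1 else 0)))"
    unfolding \<Phi>_def by (auto simp: fun_eq_iff split: split_indicator)
  then have \<Phi>m: "case_prod \<Phi> \<in> borel_measurable (borel \<Otimes>\<^sub>M borel)"
    by simp

  have "A \<le> (\<integral>\<^sup>+x. \<integral>\<^sup>+s. \<Phi> x s \<partial>lborel \<partial>lborel)"
    unfolding A_def
  proof (intro nn_integral_mono)
    fix x
    show "ennreal (\<bar>\<eta> x\<bar> powr p * T x powr (- p)) * indicator E x \<le> (\<integral>\<^sup>+s. \<Phi> x s \<partial>lborel)"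
    proof (cases "x \<in> E")
      case True
      have "ennreal (\<bar>\<eta> x\<bar> powr p) \<le> (\<integral>\<^sup>+s. ennreal (k (x + s *\<^sub>R u)) * indicator {0..<T x} s \<partial>lborel)"
        unfolding k_def
        by (rule abs_powr_le_line_integral[OF p \<eta>]) (use Tpos[OF True] in auto)
      then have "ennreal (T x powr (- p)) * ennreal (\<bar>\<eta> x\<bar> powr p) \<le>
          ennreal (T x powr (- p)) * (\<integral>\<^sup>+s. ennreal (k (x + s *\<^sub>R u)) * indicator {0..<T x} s \<partial>lborel)"
        by (rule mult_left_mono) simp
      also have "\<dots> = (\<integral>\<^sup>+s. \<Phi> x s \<partial>lborel)"
        unfolding \<Phi>_def using True by (simp add: nn_integral_cmult)
      finally show ?thesis using True by (simp add: ennreal_mult mult.commute)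
    qed simp
  qed
  \<comment> \<open>Interchange, replace \<open>x\<close> by \<open>y - s *\<^sub>R u\<close> at
    fixed \<open>s\<close>, interchange back. Now \<open>k\<close> is evaluated at \<open>y\<close>,
    free of \<open>s\<close>, and only the weight is left to integrate in \<open>s\<close>.\<close>
  also have "\<dots> = (\<integral>\<^sup>+s. \<integral>\<^sup>+x. \<Phi> x s \<partial>lborel \<partial>lborel)"
    by (rule lborel_pair.Fubini'[symmetric]) (use \<Phi>m in simp)
  also have "\<dots> = (\<integral>\<^sup>+s. \<integral>\<^sup>+y. \<Phi> (y - s *\<^sub>R u) s \<partial>lborel \<partial>lborel)"
    using \<Phi>m by (intro nn_integral_cong nn_integral_lborel_translate[symmetric]) simp
  also have "\<dots> = (\<integral>\<^sup>+y. \<integral>\<^sup>+s. \<Phi> (y - s *\<^sub>R u) s \<partial>lborel \<partial>lborel)"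
  proof (rule lborel_pair.Fubini')
    have "(\<lambda>q. case_prod \<Phi> (fst q - snd q *\<^sub>R u, snd q)) \<in> borel_measurable (borel \<Otimes>\<^sub>M borel)"
      by (rule measurable_compose[OF _ \<Phi>m]) measurable
    then show "(\<lambda>(y, s). \<Phi> (y - s *\<^sub>R u) s) \<in> borel_measurable (lborel \<Otimes>\<^sub>M lborel)"
      by (simp add: case_prod_beta')
  qed
  \<comment> \<open>A contributing start \<open>y - s *\<^sub>R u\<close> has \<open>y\<close> on
    its segment before \<open>D\<close>, so \<open>y \<in> E\<close> and the weight is
    \<open>(T y + s) powr (- p)\<close>. Admitting all \<open>s \<ge> 0\<close> only increases the
    integral.\<close>
  also have "\<dots> \<le> (\<integral>\<^sup>+y. ennreal (k y * T y powr (1 - p) / (p - 1)) * indicator E y \<partial>lborel)"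
  proof (intro nn_integral_mono)
    fix y
    have "(\<integral>\<^sup>+s. \<Phi> (y - s *\<^sub>R u) s \<partial>lborel) \<le>
      (\<integral>\<^sup>+s. (ennreal (k y) * indicator E y) * (ennreal ((T y + s) powr (- p)) * indicator {0..} s) \<partial>lborel)"
    proof (intro nn_integral_mono)
      fix s
      show "\<Phi> (y - s *\<^sub>R u) s \<le>
        (ennreal (k y) * indicator E y) * (ennreal ((T y + s) powr (- p)) * indicator {0..} s)"
      proof (cases "y - s *\<^sub>R u \<in> E \<and> 0 \<le> s \<and> s < T (y - s *\<^sub>R u)")
        case True
        then have "hits_at \<Omega> D y u (T (y - s *\<^sub>R u) - s)"
          using hits_at_shift[OF hits[of "y - s *\<^sub>R u"], of s] by simp
        from hitsD[OF this] True show ?thesis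
          by (simp add: \<Phi>_def mult_ac)
      next
        case False
        then show ?thesis by (auto simp: \<Phi>_def)
      qed
    qed
    also have "\<dots> = ennreal (k y) * indicator E y *
        (\<integral>\<^sup>+s. ennreal ((T y + s) powr (- p)) * indicator {0..} s \<partial>lborel)"
      by (rule nn_integral_cmult) simp
    also have "\<dots> = ennreal (k y * T y powr (1 - p) / (p - 1)) * indicator E y"
    proof (cases "y \<in> E")
      case True
      then show ?thesis
        using nn_integral_shifted_powr[OF p Tpos(1)] p k0[of y]
        by (simp add: ennreal_mult[symmetric])
    qed simp
    finally show "(\<integral>\<^sup>+s. \<Phi> (y - s *\<^sub>R u) s \<partial>lborel) \<le> \<dots>" .
  qed
  finally have A_le: "A \<le> (\<integral>\<^sup>+y. ennreal (k y * T y powr (1 - p) / (p - 1)) * indicator E y \<partial>lborel)" .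

  have c: "0 < c" using p by (simp add: c_def)
  define B where "B = (\<integral>\<^sup>+x. ennreal (\<bar>grad \<eta> x \<bullet> u\<bar> powr p) * indicator \<Omega> x \<partial>lborel)"
  \<comment> \<open>This is where c = (p-1)/p enters: the factor p c^p cancels the denominator p-1
    and leaves the c^(p-1) that Young's inequality absorbs.\<close>
  have cp: "p * c powr p = c powr (p - 1) * (p - 1)"
    using powr_add[of c "p - 1" 1] c p by (simp add: c_def)
  have "ennreal (p * c powr p) * A \<le>
      (\<integral>\<^sup>+y. ennreal (p * c powr p) * (ennreal (k y * T y powr (1 - p) / (p - 1)) * indicator E y) \<partial>lborel)"
    using mult_left_mono[OF A_le] by (subst nn_integral_cmult) auto
  also have "\<dots> \<le> (\<integral>\<^sup>+y. ennreal (\<bar>grad \<eta> y \<bullet> u\<bar> powr p) * indicator \<Omega> y +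
      ennreal ((p - 1) * c powr p) * (ennreal (\<bar>\<eta> y\<bar> powr p * T y powr (- p)) * indicator E y) \<partial>lborel)"
  proof (intro nn_integral_mono)
    fix y
    show "ennreal (p * c powr p) * (ennreal (k y * T y powr (1 - p) / (p - 1)) * indicator E y) \<le>
      ennreal (\<bar>grad \<eta> y \<bullet> u\<bar> powr p) * indicator \<Omega> y +
      ennreal ((p - 1) * c powr p) * (ennreal (\<bar>\<eta> y\<bar> powr p * T y powr (- p)) * indicator E y)"
    proof (cases "y \<in> E")
      case True
      \<comment> \<open>With this quotient, \<open>k y * T y powr (1 - p)\<close> equals p t^(p-1)
        |grad eta . u|.\<close>
      define t where "t = \<bar>\<eta> y\<bar> / T y"
      have T: "0 < T y" and t0: "0 \<le> t" using Tpos[OF True] by (auto simp: t_def)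
      have tp: "t powr q = \<bar>\<eta> y\<bar> powr q * T y powr (- q)" for q
        using T by (simp add: t_def powr_divide powr_minus_divide)
      have "p * c powr p * (k y * T y powr (1 - p) / (p - 1)) =
          p * (c * t) powr (p - 1) * \<bar>grad \<eta> y \<bullet> u\<bar>"
        unfolding cp using p c t0 tp[of "p - 1"] by (simp add: k_def powr_mult)
      also have "\<dots> \<le> \<bar>grad \<eta> y \<bullet> u\<bar> powr p + (p - 1) * (c * t) powr p"
        using p c t0 by (intro powr_young) auto
      also have "\<dots> = \<bar>grad \<eta> y \<bullet> u\<bar> powr p + (p - 1) * c powr p * (\<bar>\<eta> y\<bar> powr p * T y powr (- p))"
        using c t0 tp[of p] by (simp add: powr_mult)
      finally show ?thesis
        using True Tpos[OF True] p k0[of y]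
        by (simp add: ennreal_mult[symmetric] ennreal_plus[symmetric] ennreal_leI del: ennreal_plus)
    qed simp
  qed
  also have "\<dots> = B + ennreal ((p - 1) * c powr p) * A"
    unfolding A_def B_def by (subst nn_integral_add) (auto simp: nn_integral_cmult)
  finally have main: "ennreal (p * c powr p) * A \<le> B + ennreal ((p - 1) * c powr p) * A" .

  txt \<open>Finiteness is needed to absorb the last term. The distance from \<^term>\<open>D\<close> to the support of
    \<^term>\<open>\<eta>\<close> may be zero, as \<^term>\<open>D\<close> need not be closed, so a Lipschitz bound is used.\<close>
  have "A < \<infinity>"
  proof -
    have "compact (closure \<Omega>)" using dom by simp
    then have "bounded (grad \<eta> ` closure \<Omega>)"
      using \<eta> by (intro compact_imp_bounded compact_continuous_image)
        (auto intro: continuous_on_subset[OF continuous_on_grad[OF \<eta>]])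
    then obtain M where M: "\<And>x. x \<in> closure \<Omega> \<Longrightarrow> norm (grad \<eta> x) \<le> M"
      by (auto simp: bounded_iff)
    have "ennreal (\<bar>\<eta> x\<bar> powr p * T x powr (- p)) * indicator E x \<le> ennreal (M powr p) * indicator \<Omega> x" for x
    proof (cases "x \<in> E")
      case True
      note T = Tpos[OF True]
      \<comment> \<open>As \<open>\<eta>\<close> vanishes at the far end, the mean value theorem
        gives |eta(x)| <= M T(x), so the integrand of \<open>A\<close> is at most M^p.\<close>
      obtain z where z: "0 < z" "z < T x" and
        mv: "\<eta> (x + T x *\<^sub>R u) - \<eta> (x + 0 *\<^sub>R u) = (T x - 0) * (grad \<eta> (x + z *\<^sub>R u) \<bullet> u)"
        using MVT2[OF T(1) has_real_derivative_along_line[OF Ck1D(1)[OF \<eta>]]] by auto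
      have "x + z *\<^sub>R u \<in> \<Omega>" using hits[OF True] z by (auto simp: hits_at_def)
      then have "\<bar>grad \<eta> (x + z *\<^sub>R u) \<bullet> u\<bar> \<le> M"
        using Cauchy_Schwarz_ineq2[of "grad \<eta> (x + z *\<^sub>R u)" u] M[of "x + z *\<^sub>R u"] closure_subset u
        by fastforce
      moreover have "\<bar>\<eta> x\<bar> = T x * \<bar>grad \<eta> (x + z *\<^sub>R u) \<bullet> u\<bar>"
        using arg_cong[OF mv, of abs] T by (simp add: abs_mult)
      ultimately have "\<bar>\<eta> x\<bar> / T x \<le> M"
        using T by simp
      then have "(\<bar>\<eta> x\<bar> / T x) powr p \<le> M powr p"
        using p T by (intro powr_mono2) auto
      then show ?thesis using True T by (simp add: powr_divide powr_minus_divide ennreal_leI)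
    qed simp
    then have "A \<le> (\<integral>\<^sup>+x. ennreal (M powr p) * indicator \<Omega> x \<partial>lborel)"
      unfolding A_def by (intro nn_integral_mono)
    also have "\<dots> = ennreal (M powr p) * emeasure lborel \<Omega>"
      by (rule nn_integral_cmult_indicator) simp
    also have "\<dots> < \<infinity>"
      using emeasure_bounded_finite[OF dom(2)] by (simp add: ennreal_mult_less_top)
    finally show ?thesis .
  qed
  then obtain a where a: "A = ennreal a" "0 \<le> a" by (cases A) auto
  have "ennreal (c powr p) * A \<le> B"
  \<comment> \<open>For infinite \<open>B\<close> there is nothing to prove; for finite
    \<open>B\<close> the inequality \<open>main\<close> is one of real numbers and its last term can
    be subtracted.\<close>
  proof (cases B)
    case (real b)
    have "ennreal (p * c powr p * a) \<le> ennreal (b + (p - 1) * c powr p * a)"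
      using main a real p by (simp add: ennreal_mult)
    then have "p * c powr p * a \<le> b + (p - 1) * c powr p * a"
      using a real p by (subst (asm) ennreal_le_iff) auto
    then have "c powr p * a \<le> b" by (simp add: algebra_simps)
    then show ?thesis using a real by (simp add: ennreal_mult[symmetric] ennreal_leI)
  qed simp
  then show ?thesis unfolding A_eq B_def .
qed

section \<open>Averaging over directions\<close>

text \<open>\<open>measure_of\<close> keeps the prescribed sigma-algebra whatever the set function
  is, so the claim rests on the Borel sets being a sigma-algebra.\<close>

lemma sets_surface_measure [measurable_cong]: "sets surface_measure = sets borel"
  unfolding surface_measure_def hausdorff_measure_def
  by (subst sets_measure_of) (auto simp: sets.sigma_sets_eq[of borel, simplified])

lemma space_surface_measure [simp]: "space surface_measure = UNIV"
  using sets_eq_imp_space_eq[OF sets_surface_measure] by simp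

lemma
  fixes \<Omega> D :: "'a::euclidean_space set" and p :: real
  assumes dom: "open \<Omega>" "bounded \<Omega>" and disj: "D \<inter> \<Omega> = {}" and D: "D \<in> sets borel"
  shows inv_mean_distance_pow_borel_measurable:
      "inv_mean_distance_pow \<Omega> D p \<in> borel_measurable borel"
    and hardy_inequality_mean_distance:
      "\<And>\<eta>. 1 < p \<Longrightarrow> Ck_on 1 \<eta> UNIV \<Longrightarrow> (\<And>x. x \<in> D \<Longrightarrow> \<eta> x = 0) \<Longrightarrow>
        ennreal (((p - 1) / p) powr p) *
          (\<integral>\<^sup>+x\<in>\<Omega>. ennreal (\<bar>\<eta> x\<bar> powr p) * inv_mean_distance_pow \<Omega> D p x \<partial>lborel)
        \<le> (\<integral>\<^sup>+x\<in>\<Omega>. ennreal (norm (grad \<eta> x) powr p) \<partial>lborel)"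
proof -
  let ?S = "sphere 0 1 :: 'a set"
  let ?\<omega> = "emeasure surface_measure ?S"
  \<comment> \<open>Both claims are proved as one conjunction, so that the case distinction on the
    mass of the sphere is made once.\<close>
  have "inv_mean_distance_pow \<Omega> D p \<in> borel_measurable borel \<and>
    (\<forall>\<eta>. 1 < p \<longrightarrow> Ck_on 1 \<eta> UNIV \<longrightarrow> (\<forall>x\<in>D. \<eta> x = 0) \<longrightarrow>
        ennreal (((p - 1) / p) powr p) *
          (\<integral>\<^sup>+x\<in>\<Omega>. ennreal (\<bar>\<eta> x\<bar> powr p) * inv_mean_distance_pow \<Omega> D p x \<partial>lborel)
        \<le> (\<integral>\<^sup>+x\<in>\<Omega>. ennreal (norm (grad \<eta> x) powr p) \<partial>lborel))"
  proof (cases "?\<omega> = 0 \<or> ?\<omega> = \<infinity>")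
    case True
    txt \<open>Since \<open>0 / 0 = 0\<close> and \<open>x / \<infinity> = 0\<close> in \<^typ>\<open>ennreal\<close>, the average is then
      zero, so it need not be known that the sphere has finite positive surface measure.\<close>
    have "inv_mean_distance_pow \<Omega> D p x = 0" for x
    proof (cases "?\<omega> = 0")
      case True
      have ae: "AE u in surface_measure. u \<notin> ?S"
        by (rule AE_I[of _ _ ?S]) (use True in \<open>auto simp: sets_surface_measure\<close>)
      have "(\<integral>\<^sup>+u\<in>dirichlet_directions \<Omega> D x.
          ennreal (1 / dirichlet_distance \<Omega> D x u powr p) \<partial>surface_measure) = (\<integral>\<^sup>+u. 0 \<partial>(surface_measure :: 'a measure))"
        by (intro nn_integral_cong_AE eventually_mono[OF ae]) (auto simp: dirichlet_directions_def)
      then show ?thesis by (simp add: inv_mean_distance_pow_def)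
    next
      case False
      with \<open>?\<omega> = 0 \<or> ?\<omega> = \<infinity>\<close> show ?thesis
        by (simp add: inv_mean_distance_pow_def divide_ennreal_def)
    qed
    then have "inv_mean_distance_pow \<Omega> D p = (\<lambda>x. 0)" by auto
    then show ?thesis by simp
  next
    case False
    \<comment> \<open>Restricted to the sphere, the surface measure is finite in this case, which
      supplies the sigma-finiteness for Tonelli's theorem.\<close>
    define \<sigma> where "\<sigma> = density surface_measure (indicator ?S)"
    have S[measurable]: "?S \<in> sets borel" by simp
    have [measurable_cong]: "sets \<sigma> = sets borel" by (simp add: \<sigma>_def sets_surface_measure)
    have \<sigma>_UNIV: "emeasure \<sigma> (space \<sigma>) = ?\<omega>"
      unfolding \<sigma>_def
      by (subst emeasure_density) (auto simp: sets_surface_measure nn_integral_indicator)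
    interpret \<sigma>: finite_measure \<sigma>
      by (rule finite_measureI) (use \<sigma>_UNIV False in auto)
    interpret pair_sigma_finite "lborel :: 'a measure" \<sigma> ..
    define H where "H = {q :: 'a \<times> 'a. snd q \<in> dirichlet_directions \<Omega> D (fst q)}"
    define d where "d = (\<lambda>q. if q \<in> H then dirichlet_distance \<Omega> D (fst q) (snd q) else 0)"
    have [measurable]: "H \<in> sets (borel \<Otimes>\<^sub>M borel)" "d \<in> borel_measurable (borel \<Otimes>\<^sub>M borel)"
      using dirichlet_directions_borel[OF dom disj D] dirichlet_distance_borel_measurable[OF dom disj D]
      unfolding H_def d_def borel_prod by simp_all
    define \<Psi> where "\<Psi> = (\<lambda>x u. ennreal (1 / d (x, u) powr p) * indicator H (x, u))"
    have \<Psi>m[measurable]: "case_prod \<Psi> \<in> borel_measurable (borel \<Otimes>\<^sub>M borel)"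
      unfolding \<Psi>_def by measurable
    have m: "inv_mean_distance_pow \<Omega> D p x = (\<integral>\<^sup>+u. \<Psi> x u \<partial>\<sigma>) / ?\<omega>" for x
    proof -
      have "(\<integral>\<^sup>+u. \<Psi> x u \<partial>\<sigma>) = (\<integral>\<^sup>+u. indicator ?S u * \<Psi> x u \<partial>surface_measure)"
        unfolding \<sigma>_def by (rule nn_integral_density) (auto simp: sets_surface_measure)
      also have "\<dots> = (\<integral>\<^sup>+u\<in>dirichlet_directions \<Omega> D x.
          ennreal (1 / dirichlet_distance \<Omega> D x u powr p) \<partial>surface_measure)"
        by (intro nn_integral_cong)
          (auto simp: \<Psi>_def d_def H_def dirichlet_directions_def split: split_indicator)
      finally show ?thesis by (simp add: inv_mean_distance_pow_def)
    qed
    have mm: "inv_mean_distance_pow \<Omega> D p \<in> borel_measurable borel"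
      unfolding m[abs_def] using \<sigma>.borel_measurable_nn_integral[of "\<Psi>" borel] \<Psi>m by measurable
    moreover have "ennreal (((p - 1) / p) powr p) *
          (\<integral>\<^sup>+x\<in>\<Omega>. ennreal (\<bar>\<eta> x\<bar> powr p) * inv_mean_distance_pow \<Omega> D p x \<partial>lborel)
        \<le> (\<integral>\<^sup>+x\<in>\<Omega>. ennreal (norm (grad \<eta> x) powr p) \<partial>lborel)"
      if p: "1 < p" and \<eta>: "Ck_on 1 \<eta> UNIV" and zero: "\<forall>x\<in>D. \<eta> x = 0" for \<eta>
    proof -
      define C where "C = ennreal (((p - 1) / p) powr p)"
      define B where "B = (\<integral>\<^sup>+x\<in>\<Omega>. ennreal (norm (grad \<eta> x) powr p) \<partial>lborel)"
      have [measurable]: "\<eta> \<in> borel_measurable borel"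
        by (intro borel_measurable_continuous_onI Ck1D(3)[OF \<eta>])
      have [measurable]: "\<Omega> \<in> sets borel" using dom by simp
      let ?g = "\<lambda>x u. ennreal (\<bar>\<eta> x\<bar> powr p) * \<Psi> x u * indicator \<Omega> x"
      have gm: "case_prod ?g \<in> borel_measurable (lborel \<Otimes>\<^sub>M \<sigma>)"
        using \<Psi>m by measurable
      \<comment> \<open>Interchange, apply the directional inequality for each unit
        \<open>u\<close>, and integrate the bound \<open>B\<close>, constant in \<open>u\<close>;
        dividing by the mass of the sphere then recovers the average.\<close>
      have "C * (\<integral>\<^sup>+x. \<integral>\<^sup>+u. ?g x u \<partial>\<sigma> \<partial>lborel) = C * (\<integral>\<^sup>+u. \<integral>\<^sup>+x. ?g x u \<partial>lborel \<partial>\<sigma>)"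
        using Fubini'[OF gm] by simp
      also have "\<dots> = (\<integral>\<^sup>+u. C * (\<integral>\<^sup>+x. ?g x u \<partial>lborel) \<partial>\<sigma>)"
        using gm by (intro nn_integral_cmult[symmetric]) measurable
      also have "\<dots> \<le> (\<integral>\<^sup>+u. B \<partial>\<sigma>)"
      proof (intro nn_integral_mono)
        fix u :: 'a
        show "C * (\<integral>\<^sup>+x. ?g x u \<partial>lborel) \<le> B"
        proof (cases "norm u = 1")
          case True
          have "(\<integral>\<^sup>+x. ?g x u \<partial>lborel) \<le> (\<integral>\<^sup>+x. ennreal (\<bar>\<eta> x\<bar> powr p / dirichlet_distance \<Omega> D x u powr p) *
              indicator {x. u \<in> dirichlet_directions \<Omega> D x} x \<partial>lborel)"
            by (intro nn_integral_mono)
              (auto simp: \<Psi>_def d_def H_def ennreal_mult[symmetric] split: split_indicator)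
          then have "C * (\<integral>\<^sup>+x. ?g x u \<partial>lborel) \<le>
              C * (\<integral>\<^sup>+x. ennreal (\<bar>\<eta> x\<bar> powr p / dirichlet_distance \<Omega> D x u powr p) *
              indicator {x. u \<in> dirichlet_directions \<Omega> D x} x \<partial>lborel)"
            by (rule mult_left_mono) simp
          also have "\<dots> \<le> (\<integral>\<^sup>+x\<in>\<Omega>. ennreal (\<bar>grad \<eta> x \<bullet> u\<bar> powr p) \<partial>lborel)"
            unfolding C_def using directional_hardy[OF dom disj D p True \<eta>] zero by blast
          also have "\<dots> \<le> B"
            unfolding B_def using Cauchy_Schwarz_ineq2[of "grad \<eta> _" u] True p
            by (intro nn_integral_mono mult_right_mono ennreal_leI powr_mono2) auto
          finally show ?thesis .
        next
          case False
          then have "\<Psi> x u = 0" for x by (auto simp: \<Psi>_def H_def dirichlet_directions_def)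
          then show ?thesis by simp
        qed
      qed
      also have "\<dots> = B * ?\<omega>" by (simp add: \<sigma>_UNIV)
      finally have "C * (\<integral>\<^sup>+x. \<integral>\<^sup>+u. ?g x u \<partial>\<sigma> \<partial>lborel) \<le> B * ?\<omega>" .
      then have "C * (\<integral>\<^sup>+x. \<integral>\<^sup>+u. ?g x u \<partial>\<sigma> \<partial>lborel) / ?\<omega> \<le> B * ?\<omega> / ?\<omega>"
        by (rule divide_right_mono_ennreal)
      also have "\<dots> = B" using False by (intro ennreal_mult_divide_eq) auto
      also have "C * (\<integral>\<^sup>+x. \<integral>\<^sup>+u. ?g x u \<partial>\<sigma> \<partial>lborel) / ?\<omega> =
          C * (\<integral>\<^sup>+x\<in>\<Omega>. ennreal (\<bar>\<eta> x\<bar> powr p) * inv_mean_distance_pow \<Omega> D p x \<partial>lborel)"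
      proof -
        have "(\<integral>\<^sup>+x\<in>\<Omega>. ennreal (\<bar>\<eta> x\<bar> powr p) * inv_mean_distance_pow \<Omega> D p x \<partial>lborel) =
            (\<integral>\<^sup>+x. (\<integral>\<^sup>+u. ?g x u \<partial>\<sigma>) / ?\<omega> \<partial>lborel)"
        proof (intro nn_integral_cong)
          fix x :: 'a
          have "(\<integral>\<^sup>+u. ?g x u \<partial>\<sigma>) = (\<integral>\<^sup>+u. ennreal (\<bar>\<eta> x\<bar> powr p) * indicator \<Omega> x * \<Psi> x u \<partial>\<sigma>)"
            by (simp add: mult_ac)
          also have "\<dots> = ennreal (\<bar>\<eta> x\<bar> powr p) * indicator \<Omega> x * (\<integral>\<^sup>+u. \<Psi> x u \<partial>\<sigma>)"
            using \<Psi>m by (intro nn_integral_cmult) measurable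
          finally show "ennreal (\<bar>\<eta> x\<bar> powr p) * inv_mean_distance_pow \<Omega> D p x * indicator \<Omega> x =
              (\<integral>\<^sup>+u. ?g x u \<partial>\<sigma>) / ?\<omega>"
            by (simp add: m divide_ennreal_def mult_ac)
        qed
        also have "\<dots> = (\<integral>\<^sup>+x. \<integral>\<^sup>+u. ?g x u \<partial>\<sigma> \<partial>lborel) / ?\<omega>"
          using gm by (intro nn_integral_divide) measurable
        finally show ?thesis by (simp add: divide_ennreal_def mult_ac)
      qed
      finally show ?thesis unfolding C_def B_def .
    qed
    ultimately show ?thesis by blast
  qed
  then show "inv_mean_distance_pow \<Omega> D p \<in> borel_measurable borel"
    and "\<And>\<eta>. 1 < p \<Longrightarrow> Ck_on 1 \<eta> UNIV \<Longrightarrow> (\<And>x. x \<in> D \<Longrightarrow> \<eta> x = 0) \<Longrightarrow>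
        ennreal (((p - 1) / p) powr p) *
          (\<integral>\<^sup>+x\<in>\<Omega>. ennreal (\<bar>\<eta> x\<bar> powr p) * inv_mean_distance_pow \<Omega> D p x \<partial>lborel)
        \<le> (\<integral>\<^sup>+x\<in>\<Omega>. ennreal (norm (grad \<eta> x) powr p) \<partial>lborel)"
    by blast+
qed

section \<open>The fundamental eigenvalue\<close>

text \<open>By continuity the function is nonzero on a whole ball inside \<open>\<Omega>\<close>,
  which has positive volume. This keeps the denominators in \<open>lambda1\<close> away from
  zero.\<close>

lemma nn_integral_abs_powr_pos:
  fixes \<Omega> :: "'a::euclidean_space set" and \<eta> :: "'a \<Rightarrow> real"
  assumes "open \<Omega>" "continuous_on UNIV \<eta>" "x \<in> \<Omega>" "\<eta> x \<noteq> 0"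
  shows "(\<integral>\<^sup>+x\<in>\<Omega>. ennreal (\<bar>\<eta> x\<bar> powr p) \<partial>lborel) \<noteq> 0"
proof
  assume 0: "(\<integral>\<^sup>+x\<in>\<Omega>. ennreal (\<bar>\<eta> x\<bar> powr p) \<partial>lborel) = 0"
  have [measurable]: "\<eta> \<in> borel_measurable borel" "\<Omega> \<in> sets borel"
    using assms by (auto intro: borel_measurable_continuous_onI)
  have "open (\<eta> -` (- {0}) \<inter> \<Omega>)"
    using assms by (intro open_Int open_vimage) auto
  moreover have "x \<in> \<eta> -` (- {0}) \<inter> \<Omega>" using assms by simp
  ultimately obtain r where r: "0 < r" "ball x r \<subseteq> \<eta> -` (- {0}) \<inter> \<Omega>"
    using open_contains_ball by metis
  have "AE y in lborel. ennreal (\<bar>\<eta> y\<bar> powr p) * indicator \<Omega> y = 0"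
    using 0 by (subst nn_integral_0_iff_AE[symmetric]) auto
  then have "AE y in lborel. y \<notin> ball x r"
    by (rule eventually_mono) (use r(2) in \<open>auto split: split_indicator_asm\<close>)
  then have "ball x r \<in> null_sets lborel"
    by (subst AE_iff_null_sets) auto
  then have "measure lborel (ball x r) = 0" by (simp add: null_sets_def measure_def)
  then show False using content_ball_pos[OF r(1), of x] by simp
qed

lemma nn_integral_abs_powr_finite:
  fixes \<Omega> :: "'a::euclidean_space set" and \<eta> :: "'a \<Rightarrow> real"
  assumes "bounded \<Omega>" "continuous_on UNIV \<eta>" "0 < p"
  shows "(\<integral>\<^sup>+x\<in>\<Omega>. ennreal (\<bar>\<eta> x\<bar> powr p) \<partial>lborel) \<noteq> \<infinity>"
proof -
  have "compact (\<eta> ` closure \<Omega>)"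
    using assms by (intro compact_continuous_image) (auto intro: continuous_on_subset)
  then obtain M where M: "\<And>x. x \<in> closure \<Omega> \<Longrightarrow> \<bar>\<eta> x\<bar> \<le> M"
    by (metis bounded_iff compact_imp_bounded imageI real_norm_def)
  have "(\<integral>\<^sup>+x\<in>\<Omega>. ennreal (\<bar>\<eta> x\<bar> powr p) \<partial>lborel) \<le>
      (\<integral>\<^sup>+x. ennreal (M powr p) * indicator (closure \<Omega>) x \<partial>lborel)"
    using M closure_subset[of \<Omega>] assms(3)
    by (intro nn_integral_mono) (auto split: split_indicator intro!: ennreal_leI powr_mono2)
  also have "\<dots> = ennreal (M powr p) * emeasure lborel (closure \<Omega>)"
    by (rule nn_integral_cmult_indicator) simp
  also have "\<dots> < \<infinity>"
    using emeasure_bounded_finite[OF bounded_closure[OF assms(1)]] by (simp add: ennreal_mult_less_top)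
  finally show ?thesis by simp
qed

text \<open>Passes from \<open>\<zeta>\<close>, prescribed only on \<open>\<Omega>\<close>, to a
  representative that is C^1 everywhere. The gradients agree because \<open>\<Omega>\<close> is open
  and differentiation is local.\<close>

lemma test_functionsE:
  fixes \<Omega> D :: "'a::euclidean_space set"
  assumes "\<zeta> \<in> test_functions \<Omega> D" "open \<Omega>"
  obtains \<eta> where "Ck_on 1 \<eta> UNIV" "closure {x. \<eta> x \<noteq> 0} \<inter> D = {}"
    "\<And>x. x \<in> \<Omega> \<Longrightarrow> \<zeta> x = \<eta> x" "\<And>x. x \<in> \<Omega> \<Longrightarrow> grad \<zeta> x = grad \<eta> x"
proof -
  obtain \<eta> where \<eta>: "\<And>k. Ck_on k \<eta> UNIV" "closure {x. \<eta> x \<noteq> 0} \<inter> D = {}"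
    "\<And>x. x \<in> \<Omega> \<Longrightarrow> \<zeta> x = \<eta> x"
    using assms(1) by (auto simp: test_functions_def)
  have "frechet_derivative \<eta> (at x) = frechet_derivative \<zeta> (at x)" if "x \<in> \<Omega>" for x
    by (rule frechet_derivative_transform_within_open[OF Ck1D(1)[OF \<eta>(1)] assms(2) that])
      (simp_all add: \<eta>)
  then show ?thesis by (intro that[of \<eta>] \<eta>) (auto simp: grad_def)
qed

lemma le_lambda1:
  fixes \<Omega> D :: "'a::euclidean_space set"
  assumes dom: "open \<Omega>" "bounded \<Omega>" and p: "0 < p"
    and K: "\<And>\<eta>. Ck_on 1 \<eta> UNIV \<Longrightarrow> closure {x. \<eta> x \<noteq> 0} \<inter> D = {} \<Longrightarrow>
      K * (\<integral>\<^sup>+x\<in>\<Omega>. ennreal (\<bar>\<eta> x\<bar> powr p) \<partial>lborel) \<le>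
      (\<integral>\<^sup>+x\<in>\<Omega>. ennreal (norm (grad \<eta> x) powr p) \<partial>lborel)"
  shows "K \<le> lambda1 \<Omega> D p"
  unfolding lambda1_def
proof (rule INF_greatest)
  fix \<zeta> assume "\<zeta> \<in> {\<zeta> \<in> test_functions \<Omega> D. \<exists>x\<in>\<Omega>. \<zeta> x \<noteq> 0}"
  then obtain x where \<zeta>: "\<zeta> \<in> test_functions \<Omega> D" and x: "x \<in> \<Omega>" "\<zeta> x \<noteq> 0" by auto
  obtain \<eta> where \<eta>: "Ck_on 1 \<eta> UNIV" "closure {x. \<eta> x \<noteq> 0} \<inter> D = {}"
    "\<And>x. x \<in> \<Omega> \<Longrightarrow> \<zeta> x = \<eta> x" "\<And>x. x \<in> \<Omega> \<Longrightarrow> grad \<zeta> x = grad \<eta> x"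
    using test_functionsE[OF \<zeta> dom(1)] by metis
  let ?M = "\<integral>\<^sup>+x\<in>\<Omega>. ennreal (\<bar>\<eta> x\<bar> powr p) \<partial>lborel"
  let ?N = "\<integral>\<^sup>+x\<in>\<Omega>. ennreal (norm (grad \<eta> x) powr p) \<partial>lborel"
  have "?M \<noteq> 0" "?M \<noteq> \<infinity>"
    using nn_integral_abs_powr_pos[OF dom(1) Ck1D(3)[OF \<eta>(1)] x(1)]
      nn_integral_abs_powr_finite[OF dom(2) Ck1D(3)[OF \<eta>(1)] p] x \<eta>(3) by auto
  \<comment> \<open>Cancelling in \<open>ennreal\<close> is legitimate because \<open>?M\<close> is
    neither 0 nor infinite.\<close>
  then have "K = K * ?M / ?M" by (simp add: ennreal_mult_divide_eq)
  also have "\<dots> \<le> ?N / ?M" by (intro divide_right_mono_ennreal K \<eta>)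
  also have "?N = (\<integral>\<^sup>+x\<in>\<Omega>. ennreal (norm (grad \<zeta> x) powr p) \<partial>lborel)"
    by (intro nn_integral_cong) (simp add: \<eta>(4) split: split_indicator)
  also have "?M = (\<integral>\<^sup>+x\<in>\<Omega>. ennreal (\<bar>\<zeta> x\<bar> powr p) \<partial>lborel)"
    by (intro nn_integral_cong) (simp add: \<eta>(3) split: split_indicator)
  finally show "K \<le> (\<integral>\<^sup>+x\<in>\<Omega>. ennreal (norm (grad \<zeta> x) powr p) \<partial>lborel) /
      (\<integral>\<^sup>+x\<in>\<Omega>. ennreal (\<bar>\<zeta> x\<bar> powr p) \<partial>lborel)" .
qed

text \<open>Integrals, \<open>lambda1\<close> and \<open>inv_mean_distance_pow\<close> take values
  in \<open>ennreal\<close>, so the bounds are meaningful without prior finiteness. The side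
  condition in dimension one secures \<open>2 \<le> p\<close>, which in higher dimension follows
  from d < p; the stated constant is then at most the proved ((p-1)/p)^p.\<close>

theorem mainTheorem5:
  fixes \<Omega> D :: "'a::euclidean_space set" and p :: real
  assumes p: "real DIM('a) < p"
    and regular: "regular_domain \<Omega>"
    and decomposition: "boundary_decomposition \<Omega> D"
    and green: "green_formula \<Omega> D"
    and origin: "0 \<notin> closure \<Omega>"
    and starlike: "starlike_wrt_origin (frontier \<Omega> - D)"
    and away: "exterior_away_from_origin \<Omega> (frontier \<Omega> - D)"
  shows "(\<forall>\<zeta>\<in>test_functions \<Omega> D.
            (\<integral>\<^sup>+x\<in>\<Omega>. ennreal (norm (grad \<zeta> x) powr p) \<partial>lborel) \<ge>
            ennreal (((p - real DIM('a)) / p) powr p) *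
            (\<integral>\<^sup>+x\<in>\<Omega>. ennreal (\<bar>\<zeta> x / norm x\<bar> powr p) \<partial>lborel))
       \<and> lambda1 \<Omega> D p \<ge>
            ennreal (((p - real DIM('a)) / (p * (SUP x\<in>\<Omega>. norm x))) powr p)
       \<and> (\<forall>\<gamma>::real. 0 \<le> \<gamma> \<and> \<gamma> \<le> 1 \<and> (DIM('a) = 1 \<longrightarrow> 2 \<le> p) \<longrightarrow>
            lambda1 \<Omega> D p \<ge>
              (INF x\<in>\<Omega>. ennreal (\<gamma> * ((p - real DIM('a)) / (p * norm x)) powr p) +
                 ennreal ((1 - \<gamma>) * ((p - 1) powr (p - 2) / p powr p)) *
                   inv_mean_distance_pow \<Omega> D p x))"
proof -

  \<comment> \<open>Consequences of regularity and of the geometric hypotheses\<close>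
  define c where "c = (p - real DIM('a)) / p"
  have p1: "1 < p" using p DIM_positive[where 'a='a] by linarith
  have c: "0 < c" using p p1 by (simp add: c_def)
  have dom: "open \<Omega>" "bounded \<Omega>"
    using regular by (auto simp: regular_domain_def bounded_domain_def)
  have D: "D \<subseteq> frontier \<Omega>" "D \<in> sets borel"
    using decomposition by (auto simp: boundary_decomposition_def)
  have disj: "D \<inter> \<Omega> = {}"
    using D(1) dom(1) by (auto simp: frontier_def interior_open)
  have [measurable]: "\<Omega> \<in> sets borel" using dom by simp
  have pos: "0 < norm x" if "x \<in> \<Omega>" for x
    using that origin closure_subset by auto
  have C1: "AE z in surface_measure. z \<in> frontier \<Omega> \<longrightarrow> (\<exists>e r h \<phi>. C1_boundary_graph \<Omega> z e r h \<phi>)"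
    using regular by (simp add: regular_domain_def)
  \<comment> \<open>Almost every Neumann point has both a C^1 chart and an incoming ray inside
    \<open>\<Omega>\<close>.\<close>
  have normal: "AE z in surface_measure. z \<in> frontier \<Omega> - D \<longrightarrow> 0 \<le> z \<bullet> outward_normal \<Omega> z"
    using C1 away[unfolded exterior_away_from_origin_def]
    by eventually_elim (blast intro: outward_normal_inner_nonneg)
  define I where "I = (\<lambda>f. \<integral>\<^sup>+x\<in>\<Omega>. f x \<partial>(lborel :: 'a measure))"
  have hardy: "ennreal (c powr p) * I (\<lambda>x. ennreal (\<bar>\<eta> x / norm x\<bar> powr p))
      \<le> I (\<lambda>x. ennreal (norm (grad \<eta> x) powr p))"
    if "Ck_on 1 \<eta> UNIV" "closure {x. \<eta> x \<noteq> 0} \<inter> D = {}" for \<eta> :: "'a \<Rightarrow> real"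
    using hardy_inequality_origin[OF p dom green origin normal that] by (simp add: c_def I_def)
  have mean: "ennreal (((p - 1) / p) powr p) * I (\<lambda>x. ennreal (\<bar>\<eta> x\<bar> powr p) * inv_mean_distance_pow \<Omega> D p x)
      \<le> I (\<lambda>x. ennreal (norm (grad \<eta> x) powr p))"
    if "Ck_on 1 \<eta> UNIV" "closure {x. \<eta> x \<noteq> 0} \<inter> D = {}" for \<eta> :: "'a \<Rightarrow> real"
  proof -
    have "\<eta> x = 0" if "x \<in> D" for x
      using that \<open>closure {x. \<eta> x \<noteq> 0} \<inter> D = {}\<close> closure_subset[of "{x. \<eta> x \<noteq> 0}"] by blast
    then show ?thesis
      unfolding I_def by (intro hardy_inequality_mean_distance dom disj D p1 that)
  qed
  note inv_m[measurable] = inv_mean_distance_pow_borel_measurable[OF dom disj D(2)]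

  \<comment> \<open>The Hardy inequality for test functions\<close>
  have "ennreal (c powr p) * I (\<lambda>x. ennreal (\<bar>\<zeta> x / norm x\<bar> powr p))
      \<le> I (\<lambda>x. ennreal (norm (grad \<zeta> x) powr p))"
    if \<zeta>: "\<zeta> \<in> test_functions \<Omega> D" for \<zeta>
  proof -
    obtain \<eta> where \<eta>: "Ck_on 1 \<eta> UNIV" "closure {x. \<eta> x \<noteq> 0} \<inter> D = {}"
      "\<And>x. x \<in> \<Omega> \<Longrightarrow> \<zeta> x = \<eta> x" "\<And>x. x \<in> \<Omega> \<Longrightarrow> grad \<zeta> x = grad \<eta> x"
      using test_functionsE[OF \<zeta> dom(1)] by metis
    have "I (\<lambda>x. ennreal (\<bar>\<zeta> x / norm x\<bar> powr p)) = I (\<lambda>x. ennreal (\<bar>\<eta> x / norm x\<bar> powr p))"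
      "I (\<lambda>x. ennreal (norm (grad \<zeta> x) powr p)) = I (\<lambda>x. ennreal (norm (grad \<eta> x) powr p))"
      unfolding I_def by (intro nn_integral_cong; simp add: \<eta>(3,4) split: split_indicator)+
    then show ?thesis using hardy[OF \<eta>(1,2)] by simp
  qed

  \<comment> \<open>The eigenvalue bound by the largest distance from the origin\<close>
  moreover have "ennreal ((c / (SUP x\<in>\<Omega>. norm x)) powr p) \<le> lambda1 \<Omega> D p"
  proof (rule le_lambda1[OF dom])
    fix \<eta> :: "'a \<Rightarrow> real"
    assume \<eta>: "Ck_on 1 \<eta> UNIV" "closure {x. \<eta> x \<noteq> 0} \<inter> D = {}"
    let ?R = "SUP x\<in>\<Omega>. norm x"
    have [measurable]: "\<eta> \<in> borel_measurable borel"
      by (intro borel_measurable_continuous_onI Ck1D(3)[OF \<eta>(1)])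
    have bdd: "bdd_above (norm ` \<Omega>)"
      using dom(2) by (auto simp: bounded_iff bdd_above_def)
    have pt: "(c / ?R) powr p * \<bar>\<eta> x\<bar> powr p \<le> c powr p * \<bar>\<eta> x / norm x\<bar> powr p" if "x \<in> \<Omega>" for x
    proof -
      have R: "norm x \<le> ?R" using bdd that by (intro cSUP_upper)
      have "0 < ?R" using pos[OF that] R by linarith
      moreover have "c / ?R \<le> c / norm x"
        using frac_le[OF _ order.refl pos[OF that] R] c by simp
      ultimately have "(c / ?R) powr p \<le> (c / norm x) powr p"
        using powr_mono2[of p "c / ?R" "c / norm x"] c p1 by simp
      then have "(c / ?R) powr p * \<bar>\<eta> x\<bar> powr p \<le> (c / norm x) powr p * \<bar>\<eta> x\<bar> powr p"
        by (rule mult_right_mono) simp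
      also have "\<dots> = c powr p * \<bar>\<eta> x / norm x\<bar> powr p"
        using c by (simp add: powr_divide)
      finally show ?thesis .
    qed
    have "ennreal ((c / ?R) powr p) * I (\<lambda>x. ennreal (\<bar>\<eta> x\<bar> powr p)) =
        I (\<lambda>x. ennreal ((c / ?R) powr p * \<bar>\<eta> x\<bar> powr p))"
      unfolding I_def by (subst nn_integral_cmult[symmetric]) (auto simp: ennreal_mult mult.assoc)
    also have "\<dots> \<le> I (\<lambda>x. ennreal (c powr p * \<bar>\<eta> x / norm x\<bar> powr p))"
      unfolding I_def using pt by (intro nn_integral_mono) (auto intro!: ennreal_leI split: split_indicator)
    also have "\<dots> = ennreal (c powr p) * I (\<lambda>x. ennreal (\<bar>\<eta> x / norm x\<bar> powr p))"
      unfolding I_def by (subst nn_integral_cmult[symmetric]) (auto simp: ennreal_mult mult.assoc)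
    also note hardy[OF \<eta>]
    finally show "ennreal ((c / ?R) powr p) * (\<integral>\<^sup>+x\<in>\<Omega>. ennreal (\<bar>\<eta> x\<bar> powr p) \<partial>lborel) \<le>
        (\<integral>\<^sup>+x\<in>\<Omega>. ennreal (norm (grad \<eta> x) powr p) \<partial>lborel)"
      by (simp add: I_def)
  qed (use p1 in auto)

  \<comment> \<open>The eigenvalue bound combining both Hardy inequalities\<close>
  moreover have "(INF x\<in>\<Omega>. ennreal (\<gamma> * (c / norm x) powr p) +
      ennreal ((1 - \<gamma>) * ((p - 1) powr (p - 2) / p powr p)) * inv_mean_distance_pow \<Omega> D p x) \<le> lambda1 \<Omega> D p"
    (is "(INF x\<in>\<Omega>. ?V x) \<le> _")
    if \<gamma>: "0 \<le> \<gamma>" "\<gamma> \<le> 1" and one: "DIM('a) = 1 \<longrightarrow> 2 \<le> p" for \<gamma>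
  proof (rule le_lambda1[OF dom])
    fix \<eta> :: "'a \<Rightarrow> real"
    assume \<eta>: "Ck_on 1 \<eta> UNIV" "closure {x. \<eta> x \<noteq> 0} \<inter> D = {}"
    have [measurable]: "\<eta> \<in> borel_measurable borel"
      by (intro borel_measurable_continuous_onI Ck1D(3)[OF \<eta>(1)])
    have "DIM('a) = 1 \<or> 2 \<le> DIM('a)"
      using DIM_positive[where 'a='a] by linarith
    then have "2 \<le> p" using one p by fastforce
    \<comment> \<open>The base \<open>p - 1\<close> is at least 1, so raising the exponent from
      \<open>p - 2\<close> to \<open>p\<close> does not decrease the power.\<close>
    then have "(p - 1) powr (p - 2) / p powr p \<le> (p - 1) powr p / p powr p"
      by (intro divide_right_mono powr_mono) auto
    then have C: "(p - 1) powr (p - 2) / p powr p \<le> ((p - 1) / p) powr p"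
      using p1 by (simp add: powr_divide)
    let ?N = "I (\<lambda>x. ennreal (norm (grad \<eta> x) powr p))"
    let ?m = "inv_mean_distance_pow \<Omega> D p"
    \<comment> \<open>The infimum is moved under the integral and replaced by \<open>?V x\<close>.
      The result splits into \<open>\<gamma>\<close> times the integral in \<open>hardy\<close> and
      \<open>1 - \<gamma>\<close> times that in \<open>mean\<close>, each at most \<open>?N\<close>,
      with weights summing to 1.\<close>
    have "(INF x\<in>\<Omega>. ?V x) * I (\<lambda>x. ennreal (\<bar>\<eta> x\<bar> powr p)) =
        I (\<lambda>x. (INF x\<in>\<Omega>. ?V x) * ennreal (\<bar>\<eta> x\<bar> powr p))"
      unfolding I_def by (subst nn_integral_cmult[symmetric]) (auto simp: mult.assoc)
    also have "\<dots> \<le> I (\<lambda>x. ?V x * ennreal (\<bar>\<eta> x\<bar> powr p))"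
      unfolding I_def
    proof (intro nn_integral_mono)
      fix x
      show "(INF x\<in>\<Omega>. ?V x) * ennreal (\<bar>\<eta> x\<bar> powr p) * indicator \<Omega> x \<le>
          ?V x * ennreal (\<bar>\<eta> x\<bar> powr p) * indicator \<Omega> x"
        by (cases "x \<in> \<Omega>") (auto intro!: mult_right_mono INF_lower)
    qed
    also have "\<dots> = I (\<lambda>x. ennreal \<gamma> * (ennreal (c powr p) * ennreal (\<bar>\<eta> x / norm x\<bar> powr p)) +
        ennreal (1 - \<gamma>) * (ennreal ((p - 1) powr (p - 2) / p powr p) * (ennreal (\<bar>\<eta> x\<bar> powr p) * ?m x)))"
      unfolding I_def
    proof (intro nn_integral_cong)
      fix x
      have V1: "ennreal (\<gamma> * (c / norm x) powr p) * ennreal (\<bar>\<eta> x\<bar> powr p) =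
          ennreal \<gamma> * (ennreal (c powr p) * ennreal (\<bar>\<eta> x / norm x\<bar> powr p))"
        using \<gamma> c by (simp add: ennreal_mult[symmetric] powr_divide)
      have V2: "ennreal ((1 - \<gamma>) * ((p - 1) powr (p - 2) / p powr p)) =
          ennreal (1 - \<gamma>) * ennreal ((p - 1) powr (p - 2) / p powr p)"
        using \<gamma> by (intro ennreal_mult) auto
      show "?V x * ennreal (\<bar>\<eta> x\<bar> powr p) * indicator \<Omega> x =
          (ennreal \<gamma> * (ennreal (c powr p) * ennreal (\<bar>\<eta> x / norm x\<bar> powr p)) +
           ennreal (1 - \<gamma>) * (ennreal ((p - 1) powr (p - 2) / p powr p) *
             (ennreal (\<bar>\<eta> x\<bar> powr p) * ?m x))) * indicator \<Omega> x"
        unfolding V2 distrib_right V1 by (simp only: mult_ac)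
    qed
    also have "\<dots> = ennreal \<gamma> * (ennreal (c powr p) * I (\<lambda>x. ennreal (\<bar>\<eta> x / norm x\<bar> powr p))) +
        ennreal (1 - \<gamma>) * (ennreal ((p - 1) powr (p - 2) / p powr p) *
          I (\<lambda>x. ennreal (\<bar>\<eta> x\<bar> powr p) * ?m x))"
      unfolding I_def by (simp add: distrib_right nn_integral_add nn_integral_cmult mult.assoc)
    also have "\<dots> \<le> ennreal \<gamma> * ?N + ennreal (1 - \<gamma>) * ?N"
    proof (intro add_mono mult_left_mono hardy \<eta>)
      have "ennreal ((p - 1) powr (p - 2) / p powr p) * I (\<lambda>x. ennreal (\<bar>\<eta> x\<bar> powr p) * ?m x) \<le>
          ennreal (((p - 1) / p) powr p) * I (\<lambda>x. ennreal (\<bar>\<eta> x\<bar> powr p) * ?m x)"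
        using C by (intro mult_right_mono ennreal_leI) auto
      also note mean[OF \<eta>]
      finally show "ennreal ((p - 1) powr (p - 2) / p powr p) * I (\<lambda>x. ennreal (\<bar>\<eta> x\<bar> powr p) * ?m x) \<le> ?N" .
    qed auto
    also have "\<dots> = ?N"
      using \<gamma> by (simp add: distrib_right[symmetric] ennreal_plus[symmetric] del: ennreal_plus)
    finally show "(INF x\<in>\<Omega>. ?V x) * (\<integral>\<^sup>+x\<in>\<Omega>. ennreal (\<bar>\<eta> x\<bar> powr p) \<partial>lborel) \<le>
        (\<integral>\<^sup>+x\<in>\<Omega>. ennreal (norm (grad \<eta> x) powr p) \<partial>lborel)"
      by (simp add: I_def)
  qed (use p1 in auto)
  ultimately show ?thesis
    unfolding c_def I_def divide_divide_eq_left by blast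
qed

end
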